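(* Let $m > 1$ be an integer. (1) The set $\{ (d/c,\ S(d,c) \bmod m) : 1 \leq d < c,\ (d,c) = 1,\ c+d \text{ odd} \}$ is uniformly distributed on $\mathbf{R}/\mathbf{Z} \times \mathbf{Z}/m\mathbf{Z}$ as $c \to +\infty$. That is, with $\Phi_\theta(N) = \{ d/c : 1 \leq d < c \leq N,\ (d,c)=1,\ c+d \text{ odd}\}$, for every continuous function $f : \mathbf{R}/\mathbf{Z} \times \mathbf{Z}/m\mathbf{Z} \to \mathbf{C}$, $$\frac{1}{\#\Phi_\theta(N)} \sum_{d/c \in \Phi_\theta(N)} f\big(d/c,\ S(d,c) \bmod m\big) \longrightarrow \int f \, d\mu \quad \text{as } N \to +\infty .$$ (2) The set $\{ (d/c,\ S_4(d,c) \bmod m) : 1 \leq d < c,\ (d,c) = 1,\ d \text{ odd} \}$ is uniformly distributed on $\mathbf{R}/\mathbf{Z} \times \mathbf{Z}/m\mathbf{Z}$ as $c \to +\infty$. That is, with $\Phi_4(N) = \{ d/c : 1 \leq d < c \leq N,\ (d,c)=1,\ d \text{ odd}\}$, for every continuous function $f : \mathbf{R}/\mathbf{Z} \times \mathbf{Z}/m\mathbf{Z} \to \mathbf{C}$, $$\frac{1}{\#\Phi_4(N)} \sum_{d/c \in \Phi_4(N)} f\big(d/c,\ S_4(d,c) \bmod m\big) \longrightarrow \int f \, d\mu \quad \text{as } N \to +\infty .$$ Here $\mu$ is the Haar probability measure on $\mathbf{R}/\mathbf{Z} \times \mathbf{Z}/m\mathbf{Z}$.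
   Context: Fractions $d/c$ are always written in lowest terms with $c>0$, and $(d,c)$ denotes the greatest common divisor. The Hardy sums are the integers $$S(d,c) = \sum_{k=1}^{|c|-1} (-1)^{k+1+\lfloor dk/c \rfloor} \quad ((d,c)=1,\ c+d \text{ odd}),$$ $$S_4(d,c) = \sum_{k=1}^{|c|-1} (-1)^{\lfloor dk/c \rfloor} \quad ((d,c)=1,\ d \text{ odd}).$$ The Haar probability measure on $\mathbf{R}/\mathbf{Z} \times \mathbf{Z}/m\mathbf{Z}$ is the product of Lebesgue measure on $\mathbf{R}/\mathbf{Z}$ and the normalized counting measure on $\mathbf{Z}/m\mathbf{Z}$. "Uniformly distributed as $c\to+\infty$" refers to averaging over all admissible fractions with denominator $c \le N$ and letting $N \to +\infty$. *)

theory Defs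
  imports "HOL-Analysis.Analysis"
begin

definition rz_rel :: "real \<Rightarrow> real \<Rightarrow> bool" where
  "rz_rel x y \<longleftrightarrow> x - y \<in> \<int>"

lemma equivp_rz_rel: "equivp rz_rel"
proof (rule equivpI)
  show "reflp rz_rel"
    by (auto intro!: reflpI simp: rz_rel_def)
  show "symp rz_rel"
    by (auto intro!: sympI simp: rz_rel_def) (metis Ints_minus minus_diff_eq)
  show "transp rz_rel"
  proof (rule transpI)
    fix x y z assume "rz_rel x y" "rz_rel y z"
    then have "(x - y) + (y - z) \<in> \<int>"
      unfolding rz_rel_def by (rule Ints_add)
    then show "rz_rel x z" by (simp add: rz_rel_def)
  qed
qed

quotient_type real_mod_1 = real / rz_rel
  by (rule equivp_rz_rel)

lift_definition to_rz :: "real \<Rightarrow> real_mod_1" is "\<lambda>x. x" .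

text \<open>The quotient topology.\<close>

instantiation real_mod_1 :: topological_space
begin

definition open_real_mod_1 :: "real_mod_1 set \<Rightarrow> bool" where
  "open_real_mod_1 U \<longleftrightarrow> open (to_rz -` U)"

instance
proof
  show "open (UNIV :: real_mod_1 set)"
    by (simp add: open_real_mod_1_def)
  show "open (U \<inter> V)" if "open U" "open V" for U V :: "real_mod_1 set"
    using that by (simp add: open_real_mod_1_def vimage_Int open_Int)
  show "open (\<Union>K)" if "\<forall>U\<in>K. open U" for K :: "real_mod_1 set set"
    using that by (auto simp: open_real_mod_1_def vimage_Union)
qed

end

lemma to_rz_eq_iff: "to_rz x = to_rz y \<longleftrightarrow> x - y \<in> \<int>"
  by transfer (simp add: rz_rel_def)

lemma continuous_on_to_rz: "continuous_on A to_rz"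
  by (rule continuous_on_subset[of UNIV])
    (auto simp: continuous_on_open_vimage open_real_mod_1_def)

definition lebesgue_rz :: "real_mod_1 measure" where
  "lebesgue_rz = distr (uniform_measure lborel {0..<1}) borel to_rz"

text \<open>
  The ring of integers modulo \<open>m\<close> is represented by the residues \<open>{0..<m}\<close>, so that the class of
  \<open>s\<close> is \<open>s mod m\<close>; the topology it inherits from the type of integers is the discrete one.
\<close>

definition haar_rz_zm :: "int \<Rightarrow> (real_mod_1 \<times> int) measure" where
  "haar_rz_zm m = lebesgue_rz \<Otimes>\<^sub>M uniform_count_measure {0..<m}"

text \<open>
  In the Hardy sums the exponent is an integer, negative in general when \<open>d / c < 0\<close>. Taking its
  absolute value keeps the parity and allows the power to be formed in the integers.
\<close>

definition hardy_S :: "int \<Rightarrow> int \<Rightarrow> int" where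
  "hardy_S d c = (\<Sum>k = 1..\<bar>c\<bar> - 1. (-1) ^ nat \<bar>k + 1 + \<lfloor>real_of_int (d * k) / real_of_int c\<rfloor>\<bar>)"

definition hardy_S4 :: "int \<Rightarrow> int \<Rightarrow> int" where
  "hardy_S4 d c = (\<Sum>k = 1..\<bar>c\<bar> - 1. (-1) ^ nat \<bar>\<lfloor>real_of_int (d * k) / real_of_int c\<rfloor>\<bar>)"

text \<open>
  A fraction \<open>d / c\<close> in lowest terms with \<open>c > 0\<close> is represented by the pair \<open>(d, c)\<close>.
\<close>

definition Phi_theta :: "nat \<Rightarrow> (int \<times> int) set" where
  "Phi_theta N = {(d, c). 1 \<le> d \<and> d < c \<and> c \<le> int N \<and> coprime d c \<and> odd (c + d)}"

definition Phi_4 :: "nat \<Rightarrow> (int \<times> int) set" where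
  "Phi_4 N = {(d, c). 1 \<le> d \<and> d < c \<and> c \<le> int N \<and> coprime d c \<and> odd d}"

end

theory Submission
  imports Defs
begin

text \<open>
  Since \<open>S(d, c) = S\<^sub>4(c - d, c)\<close>, it suffices to treat \<open>S\<^sub>4\<close>. Let \<open>p/q\<close> be a fraction with \<open>p\<close> even and
  \<open>q\<close> odd. If \<open>t = dq - cp > 0\<close> is small compared with \<open>c/q\<close>, then
  \<open>S\<^sub>4(d + tp, c + tq) = S\<^sub>4(d, c) + 1\<close>. Hence \<open>S\<^sub>4\<close> runs evenly through the residues modulo \<open>m\<close> along
  each such chain of fractions approaching \<open>p/q\<close>, and in the strip \<open>[p/q, p/q + \<epsilon>/q\<^sup>2)\<close> the imbalance
  between residue classes is at most \<open>m\<epsilon>\<close> times the length of the strip times \<open>N\<^sup>2\<close>. Disjoint strips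
  fill a fixed proportion \<open>\<kappa>\<close> of every interval. So if the imbalance in every interval is
  asymptotically at most \<open>K\<close> times its length times \<open>N\<^sup>2\<close>, then the same holds with
  \<open>(1 - \<kappa>)K + \<kappa>m\<epsilon>\<close>; iterating brings the constant arbitrarily close to \<open>m\<epsilon>\<close>, and \<open>\<epsilon>\<close> is
  arbitrary.
\<close>

subsection \<open>Hardy sums\<close>

text \<open>The increment rests on S_4(t, s + t) = S_4(t, s) + 1 for odd t. If (p', q'), (p, q) is a
  basis of determinant one and (d, c) = t (p', q') + s (p, q), then S_4(d, c) and S_4(t, s) differ
  by a constant on the whole cone s, t > 0, and the chain step becomes s \<mapsto> s + t. Evenness
  of p is what makes t odd whenever d is odd.

  The constant m \<epsilon> arises as follows. The strip at p/q meets at most \<epsilon> N / q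
  values of t, and for each of them all but m t terms cancel, so the imbalance is at most m
  (\<epsilon> N / q)^2 = m \<epsilon> * (\<epsilon> / q^2) * N^2; the second factor is the length of
  the strip.

  The obstacle is that the strips at one scale are only shown to fill a proportion of an interval,
  and nothing is known on the gaps. Therefore the bound is stated for all intervals at once with one
  constant K: the gaps are intervals too, and K applies to them. Both the first K and the supply of
  strips come from counting coprime pairs with parity conditions in sectors.\<close>

lemma le_div_iff_mult_le_int:
  fixes m n q :: int
  assumes "q > 0"
  shows "m \<le> n div q \<longleftrightarrow> m * q \<le> n"
proof
  assume "m \<le> n div q"
  then have "m * q \<le> n div q * q" using assms by simp
  also have "\<dots> \<le> n"
    using assms pos_mod_sign[of q n] div_mult_mod_eq[of n q] by linarith
  finally show "m * q \<le> n" .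
next
  assume "m * q \<le> n"
  then have "m * q div q \<le> n div q" using assms by (rule zdiv_mono1)
  then show "m \<le> n div q" using assms by simp
qed

lemma hardy_S4_eq:
  assumes "c > 0"
  shows "hardy_S4 d c = (\<Sum>k = 1..c - 1. if even (d * k div c) then 1 else - 1)"
proof -
  have "\<lfloor>real_of_int (d * k) / real_of_int c\<rfloor> = d * k div c" for k
    by (rule floor_divide_of_int_eq)
  then show ?thesis
    using assms unfolding hardy_S4_def
    by (auto intro!: sum.cong simp: minus_one_power_iff even_nat_iff)
qed

text \<open>Adding \<open>c\<close> to \<open>d\<close> raises the quotient at \<open>k\<close> by
  exactly \<open>k\<close>, which accounts for the factor (-1)^k in S; the remaining summand 1 of
  the exponent is the minus sign.\<close>

lemma hardy_S_eq:
  assumes "c > 0"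
  shows "hardy_S d c = - hardy_S4 (d + c) c"
proof -
  have fl: "\<lfloor>real_of_int (d * k) / real_of_int c\<rfloor> = d * k div c" for k
    by (rule floor_divide_of_int_eq)
  have "(d + c) * k div c = d * k div c + k" for k
    using assms by (simp add: distrib_right)
  then show ?thesis
    using assms unfolding hardy_S4_eq[OF assms] hardy_S_def fl sum_negf[symmetric]
    by (intro sum.cong) (auto simp: minus_one_power_iff even_nat_iff)
qed

lemma hardy_S4_shift:
  assumes "c > 0"
  shows "hardy_S4 (d + 2 * c) c = hardy_S4 d c"
proof -
  have "(d + 2 * c) * k div c = d * k div c + 2 * k" for k
  proof -
    have "(d + 2 * c) * k = d * k + c * (2 * k)" by (simp add: algebra_simps)
    then show ?thesis using assms by simp
  qed
  then show ?thesis
    by (simp add: hardy_S4_eq[OF assms])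
qed

text \<open>By coprimality d k / c is never an integer for 0 < k < c, so the floor of its negative
  is -1 minus its floor, and every sign flips.\<close>

lemma hardy_S4_uminus:
  assumes "c > 0" "coprime d c"
  shows "hardy_S4 (- d) c = - hardy_S4 d c"
proof -
  have "- d * k div c = - (d * k div c) - 1" if "k \<in> {1..c - 1}" for k
  proof -
    have "\<not> c dvd k"
      using that zdvd_not_zless by auto
    then have "\<not> c dvd d * k"
      using assms(2) by (metis coprime_commute coprime_dvd_mult_right_iff)
    then have "(d * k) mod c \<noteq> 0" by (simp add: dvd_eq_mod_eq_0)
    then show ?thesis
      using zdiv_zminus1_eq_if[of c "d * k"] assms(1) by simp
  qed
  then show ?thesis
    unfolding hardy_S4_eq[OF assms(1)] sum_negf[symmetric]
    by (intro sum.cong) auto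
qed

lemma hardy_S4_reflect:
  assumes "c > 0" "coprime d c"
  shows "hardy_S4 (2 * c - d) c = - hardy_S4 d c"
  using hardy_S4_shift[OF assms(1), of "- d"] hardy_S4_uminus[OF assms] by simp

lemma sum_alternating_odd:
  assumes "odd d" "d > (0::int)"
  shows "(\<Sum>j = 0..<d. if even j then 1 else - 1) = (1::int)"
proof -
  obtain k where k: "d = 2 * k + 1" using assms(1) by (elim oddE)
  define n where "n = nat k"
  have n: "d = 2 * int n + 1" using k assms(2) by (simp add: n_def)
  have "(\<Sum>j = 0..<2 * int n + 1. if even j then 1 else - 1) = (1::int)"
  proof (induction n)
    case (Suc n)
    have "{0..<2 * int (Suc n) + 1} =
        insert (2 * int n + 1) (insert (2 * int n + 2) {0..<2 * int n + 1})"
      by auto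
    then show ?case using Suc by simp
  next
    case 0
    have "{0..<1} = {0::int}" by auto
    then show ?case by simp
  qed
  then show ?thesis by (simp add: n)
qed

text \<open>Grouping by the value \<open>j\<close> of the quotient: \<open>j\<close> is attained \<open>\<lceil>(j+1)c/d\<rceil> - \<lceil>jc/d\<rceil>\<close> times.\<close>

lemma hardy_S4_eq_ceil:
  assumes "d > 0" "c > 0"
  shows "hardy_S4 d c =
    (\<Sum>j = 0..<d. (if even j then 1 else - 1) * ((- (j * c)) div d - (- ((j + 1) * c)) div d)) - 1"
proof -
  let ?sg = "\<lambda>j::int. if even j then 1 else - 1 :: int"
  have "(\<Sum>k = 0..<c. ?sg (d * k div c)) =
      (\<Sum>j = 0..<d. \<Sum>k | k \<in> {0..<c} \<and> d * k div c = j. ?sg (d * k div c))"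
  proof (rule sum.group[symmetric])
    show "(\<lambda>k. d * k div c) ` {0..<c} \<subseteq> {0..<d}"
      using assms by (auto simp: pos_imp_zdiv_nonneg_iff not_le[symmetric]
          le_div_iff_mult_le_int)
  qed auto
  also have "\<dots> = (\<Sum>j = 0..<d. ?sg j * ((- (j * c)) div d - (- ((j + 1) * c)) div d))"
  proof (intro sum.cong refl)
    fix j assume j: "j \<in> {0..<d}"
    \<comment> \<open>\<open>- (x div d)\<close> is the ceiling of - x / d, and this is its defining
      property.\<close>
    have le: "- (x div d) \<le> k \<longleftrightarrow> - x \<le> d * k" for k x
    proof -
      have "- (x div d) \<le> k \<longleftrightarrow> - k \<le> x div d" by linarith
      also have "\<dots> \<longleftrightarrow> - k * d \<le> x" using assms(1) by (rule le_div_iff_mult_le_int)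
      finally show ?thesis by (auto simp: algebra_simps)
    qed
    have "d * k div c = j \<longleftrightarrow> j * c \<le> d * k \<and> d * k < (j + 1) * c" for k
      using le_div_iff_mult_le_int[OF assms(2), of j "d * k"]
        le_div_iff_mult_le_int[OF assms(2), of "j + 1" "d * k"] by linarith
    moreover have "k \<in> {0..<c}" if "j * c \<le> d * k" "d * k < (j + 1) * c" for k
    proof -
      have "0 \<le> j * c" using j assms by simp
      moreover have "(j + 1) * c \<le> d * c" using j assms by (intro mult_right_mono) auto
      ultimately have "0 \<le> d * k" "d * k < d * c" using that by linarith+
      then show ?thesis using assms(1) by (simp add: zero_le_mult_iff)
    qed
    ultimately have *: "k \<in> {0..<c} \<and> d * k div c = j \<longleftrightarrow> j * c \<le> d * k \<and> d * k < (j + 1) * c" for k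
      by blast
    have "j * c \<le> d * k \<longleftrightarrow> - ((- (j * c)) div d) \<le> k"
      "d * k < (j + 1) * c \<longleftrightarrow> k < - ((- ((j + 1) * c)) div d)" for k
      using le[of "- (j * c)" k] le[of "- ((j + 1) * c)" k] by linarith+
    then have "{k. k \<in> {0..<c} \<and> d * k div c = j} =
        {- ((- (j * c)) div d)..<- ((- ((j + 1) * c)) div d)}"
      unfolding * by auto
    moreover have "(- ((j + 1) * c)) div d \<le> (- (j * c)) div d"
      using assms by (intro zdiv_mono1) (auto simp: algebra_simps)
    ultimately have "int (card {k. k \<in> {0..<c} \<and> d * k div c = j}) =
        (- (j * c)) div d - (- ((j + 1) * c)) div d"
      by simp
    moreover have "(\<Sum>k | k \<in> {0..<c} \<and> d * k div c = j. ?sg (d * k div c)) =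
        (\<Sum>k | k \<in> {0..<c} \<and> d * k div c = j. ?sg j)"
      by (rule sum.cong) auto
    ultimately show "(\<Sum>k | k \<in> {0..<c} \<and> d * k div c = j. ?sg (d * k div c)) =
        ?sg j * ((- (j * c)) div d - (- ((j + 1) * c)) div d)"
      by (simp add: mult.commute)
  qed
  finally have "(\<Sum>k = 0..<c. ?sg (d * k div c)) = 
    (\<Sum>j = 0..<d. ?sg j * ((- (j * c)) div d - (- ((j + 1) * c)) div d))" .
  \<comment> \<open>The term k = 0 has quotient 0 and contributes 1, which the final
    \<open>- 1\<close> of the formula removes.\<close>
  moreover have "{0..<c} = insert 0 {1..c - 1}" using assms by auto
  ultimately show ?thesis
    by (simp add: hardy_S4_eq[OF assms(2)])
qed

text \<open>In the ceiling formula, passing from c to c + d raises the ceiling of j c / d by j,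
  hence every multiplicity by exactly one. The increment is therefore the alternating sum of d
  signs, which is 1 because d is odd.\<close>

lemma hardy_S4_add:
  assumes "odd d" "d > 0" "c > 0"
  shows "hardy_S4 d (c + d) = hardy_S4 d c + 1"
proof -
  have "(- (j * (c + d))) div d = (- (j * c)) div d - j" for j
  proof -
    have "- (j * (c + d)) = - (j * c) + d * (- j)" by (simp add: algebra_simps)
    then show ?thesis using assms(2) by (simp only: div_mult_self2)
  qed
  then have "(\<Sum>j = 0..<d. (if even j then 1 else - 1) *
        ((- (j * (c + d))) div d - (- ((j + 1) * (c + d))) div d)) =
      (\<Sum>j = 0..<d. (if even j then 1 else - 1) * ((- (j * c)) div d - (- ((j + 1) * c)) div d)
        + (if even j then 1 else - 1))"
    by (intro sum.cong refl) (simp only:, simp add: algebra_simps)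
  then show ?thesis
    using assms by (simp add: hardy_S4_eq_ceil sum.distrib sum_alternating_odd)
qed

lemma hardy_S4_add_mult:
  assumes "odd d" "d > 0" "c > 0"
  shows "hardy_S4 d (c + int n * d) = hardy_S4 d c + int n"
proof (induction n)
  case (Suc n)
  have "c + int n * d > 0" using assms by (simp add: add_pos_nonneg)
  from hardy_S4_add[OF assms(1,2) this] show ?case
    using Suc by (simp add: algebra_simps)
qed simp

section \<open>Unimodular changes of basis\<close>

lemma coprime_unimodular_combination:
  fixes a b c d s t :: int
  assumes "\<bar>a * d - b * c\<bar> = 1" "coprime s t"
  shows "coprime (s * a + t * b) (s * c + t * d)"
proof (rule coprimeI)
  fix g assume g: "g dvd s * a + t * b" "g dvd s * c + t * d"
  have "s * (a * d - b * c) = (s * a + t * b) * d - (s * c + t * d) * b"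
    "t * (a * d - b * c) = (s * c + t * d) * a - (s * a + t * b) * c"
    by (simp_all add: algebra_simps)
  then have "g dvd s * (a * d - b * c)" "g dvd t * (a * d - b * c)"
    using g by (metis dvd_diff dvd_mult2)+
  moreover have "is_unit (a * d - b * c)" using assms(1) by (simp add: abs_eq_iff zdvd1_eq)
  ultimately have "g dvd s" "g dvd t"
    by (simp_all add: dvd_mult_unit_iff)
  then show "is_unit g" using assms(2) coprime_common_divisor by blast
qed

text \<open>
  The induction descends the Stern--Brocot tree towards the cone spanned by \<open>(1, q')\<close> and \<open>(0, 1)\<close>.
  Since \<open>p\<close> must stay even, cones between the slopes 1 and 2 are handled by the reflection
  \<open>d \<mapsto> 2c - d\<close>, which reverses both the orientation and the sign of \<open>S\<^sub>4\<close>.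
\<close>

lemma hardy_S4_cone:
  fixes p p' q q' D :: int
  assumes "p \<ge> 0" "p' \<ge> 0" "q > 0" "q' \<ge> 0" "even p" "odd p'"
    and "p' * q - q' * p = D" "\<bar>D\<bar> = 1"
  shows "\<exists>k. \<forall>s t. s > 0 \<longrightarrow> t > 0 \<longrightarrow> odd t \<longrightarrow> coprime t s \<longrightarrow>
    hardy_S4 (t * p' + s * p) (t * q' + s * q) = D * hardy_S4 t s + k"
  using assms
proof (induction "nat (p + p' + q + q')" arbitrary: p p' q q' D rule: less_induct)
  case less
  note prems = less.prems
  have p': "p' \<ge> 1" using prems by (cases "p' = 0") auto
  have cop: "coprime (t * p' + s * p) (t * q' + s * q)" if "coprime t s" for s t
    using coprime_unimodular_combination[of p' q p q' t s] that prems by (simp add: mult.commute)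
  have cpos: "t * q' + s * q > 0" if "s > 0" "t > 0" for s t
    using that prems by (simp add: add_nonneg_pos)
  have dpos: "t * p' + s * p > 0" if "s > 0" "t > 0" for s t
    using that prems p' by (simp add: add_pos_nonneg)
  have dodd: "odd (t * p' + s * p)" if "odd t" for s t
    using that prems by simp
  have "p \<noteq> q"
  proof
    assume "p = q"
    then have "p * (p' - q') = D" using prems by (simp add: algebra_simps)
    then have "p dvd D" by auto
    moreover have "odd D" using prems(8) by (cases "D \<ge> 0") auto
    ultimately show False using prems(5) dvd_trans by blast
  qed
  consider "p = 0" | "p > 0" "p \<le> q" "p' \<le> q'" | "p > 0" "2 * q \<le> p" "2 * q' \<le> p'"
    | "q < p" "q' \<le> p'" "p \<le> 2 * q" "p' \<le> 2 * q'"
  proof -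
    \<comment> \<open>Determinant 1 or -1 prevents the line of slope n from separating the two
      generators strictly: otherwise D or -D is a sum of two nonnegative products, the first at
      least 1. Only q' = 0 makes the second one vanish; then q = 1 and p < n \<le> 2, impossible for
      a positive even p.\<close>
    have side: "p \<le> n * q \<and> p' \<le> n * q' \<or> n * q \<le> p \<and> n * q' \<le> p'" if "p > 0" "n > 0" "n \<le> 2" for n
    proof (rule ccontr)
      assume "\<not> ?thesis"
      then consider "n * q < p" "p' < n * q'" | "p < n * q" "n * q' < p'" by linarith
      then show False
      proof cases
        case 1
        then have "q' > 0" using prems(2,4) by (cases "q' = 0") auto
        then have "(n * q' - p') * q \<ge> 1" "q' * (p - n * q) \<ge> 1"
          using 1 prems by (simp_all add: int_one_le_iff_zero_less)
        then show False using prems by (simp add: algebra_simps)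
      next
        case 2
        have 3: "(p' - n * q') * q + q' * (n * q - p) = D" using prems by (simp add: algebra_simps)
        have 4: "(p' - n * q') * q \<ge> 1" using 2 prems by (simp add: int_one_le_iff_zero_less)
        have 5: "q' * (n * q - p) \<ge> q'" using 2 prems by (simp add: mult_le_cancel_left1)
        have "q' = 0" using 3 4 5 prems by linarith
        then have "p' * q = 1" using 3 4 prems by simp
        then have "p' = 1" "q = 1" using prems p' by (simp_all add: zmult_eq_1_iff)
        moreover have "p \<ge> 2" using prems that by presburger
        ultimately show False using 2 that by simp
      qed
    qed
    have lin: "p > 0 \<Longrightarrow> p \<le> q \<and> p' \<le> q' \<or> q \<le> p \<and> q' \<le> p'"
      "p > 0 \<Longrightarrow> p \<le> 2 * q \<and> p' \<le> 2 * q' \<or> 2 * q \<le> p \<and> 2 * q' \<le> p'"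
      using side[of 1] side[of 2] by simp_all
    show ?thesis
    proof (cases "p = 0 \<or> p \<le> q \<and> p' \<le> q'")
      case True
      then show ?thesis using that(1,2) prems(1) by (cases "p = 0") auto
    next
      case False
      then have "p > 0" "q < p" "q' \<le> p'" using lin(1) prems(1) \<open>p \<noteq> q\<close> by auto
      then show ?thesis using that(3,4) lin(2) by auto
    qed
  qed
  then show ?case
  proof cases
    case 1
    \<comment> \<open>End of the descent: here p' = q = D = 1, the point is (t, s + q' t), and q'
      applications of the increment give k = q'.\<close>
    then have "p' * q = D" using prems by simp
    moreover have "p' * q > 0" using prems p' by simp
    ultimately have "p' * q = 1" using prems(8) by linarith
    then have 2: "p' = 1" "q = 1" "D = 1" using prems p' 1 by (auto simp: zmult_eq_1_iff)
    have "hardy_S4 (t * p' + s * p) (t * q' + s * q) = D * hardy_S4 t s + q'"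
      if "s > 0" "t > 0" "odd t" for s t
      using hardy_S4_add_mult[OF that(3,2,1), of "nat q'"] prems 1 2
      by (simp add: algebra_simps)
    then show ?thesis by blast
  next
    case 2
    have "\<exists>k. \<forall>s t. s > 0 \<longrightarrow> t > 0 \<longrightarrow> odd t \<longrightarrow> coprime t s \<longrightarrow>
      hardy_S4 (t * p' + s * p) (t * (q' - p') + s * (q - p)) = D * hardy_S4 t s + k"
    proof (rule less.hyps)
      show "q - p > 0" using 2 \<open>p \<noteq> q\<close> by simp
    qed (use prems 2 p' in \<open>auto simp: algebra_simps\<close>)
    then obtain k where k: "hardy_S4 (t * p' + s * p) (t * (q' - p') + s * (q - p)) = D * hardy_S4 t s + k"
      if "s > 0" "t > 0" "odd t" "coprime t s" for s t by blast
    have "hardy_S4 (t * p' + s * p) (t * q' + s * q) = D * hardy_S4 t s + (k + 1)"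
      if st: "s > 0" "t > 0" "odd t" "coprime t s" for s t
    proof -
      have "q - p > 0" using 2 \<open>p \<noteq> q\<close> by simp
      then have "t * (q' - p') + s * (q - p) > 0" using 2 st by (simp add: add_nonneg_pos)
      from hardy_S4_add[OF dodd[OF st(3)] dpos[OF st(1,2)] this] show ?thesis
        using k[OF st] by (simp add: algebra_simps)
    qed
    then show ?thesis by blast
  next
    case 3
    have "\<exists>k. \<forall>s t. s > 0 \<longrightarrow> t > 0 \<longrightarrow> odd t \<longrightarrow> coprime t s \<longrightarrow>
      hardy_S4 (t * (p' - 2 * q') + s * (p - 2 * q)) (t * q' + s * q) = D * hardy_S4 t s + k"
      by (rule less.hyps) (use prems 3 in \<open>auto simp: algebra_simps\<close>)
    then obtain k where k: "hardy_S4 (t * (p' - 2 * q') + s * (p - 2 * q)) (t * q' + s * q) = D * hardy_S4 t s + k"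
      if "s > 0" "t > 0" "odd t" "coprime t s" for s t by blast
    have "hardy_S4 (t * p' + s * p) (t * q' + s * q) = D * hardy_S4 t s + k"
      if st: "s > 0" "t > 0" "odd t" "coprime t s" for s t
      using hardy_S4_shift[OF cpos[OF st(1,2)], of "t * (p' - 2 * q') + s * (p - 2 * q)"] k[OF st]
      by (simp add: algebra_simps)
    then show ?thesis by blast
  next
    case 4
    \<comment> \<open>After the reflection both slopes lie between 0 and 1. Since q < p and q' \<le>
      p', replacing p, p' by 2 q - p, 2 q' - p' lowers the measure.\<close>
    have "\<exists>k. \<forall>s t. s > 0 \<longrightarrow> t > 0 \<longrightarrow> odd t \<longrightarrow> coprime t s \<longrightarrow>
      hardy_S4 (t * (2 * q' - p') + s * (2 * q - p)) (t * q' + s * q) = (- D) * hardy_S4 t s + k"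
      by (rule less.hyps) (use prems 4 in \<open>auto simp: algebra_simps\<close>)
    then obtain k where k: "hardy_S4 (t * (2 * q' - p') + s * (2 * q - p)) (t * q' + s * q) = (- D) * hardy_S4 t s + k"
      if "s > 0" "t > 0" "odd t" "coprime t s" for s t by blast
    have "hardy_S4 (t * p' + s * p) (t * q' + s * q) = D * hardy_S4 t s + (- k)"
      if st: "s > 0" "t > 0" "odd t" "coprime t s" for s t
    proof -
      have "2 * (t * q' + s * q) - (t * p' + s * p) = t * (2 * q' - p') + s * (2 * q - p)"
        by (simp add: algebra_simps)
      then show ?thesis
        using hardy_S4_reflect[OF cpos[OF st(1,2)] cop[OF st(4)]] k[OF st] by simp
    qed
    then show ?thesis by blast
  qed
qed

subsection \<open>Balance of residues near a fraction\<close>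

text \<open>The sector is described with denominators cleared, so its condition is homogeneous:
  multiplying (d, c) by e affects only the bound N. \<open>Q\<close> is a parameter because the
  counting compares the same sector with and without coprimality.\<close>

definition pts :: "(int \<Rightarrow> int \<Rightarrow> bool) \<Rightarrow> real \<Rightarrow> real \<Rightarrow> nat \<Rightarrow> (int \<times> int) set" where
  "pts Q a b N = {(d, c). 1 \<le> c \<and> c \<le> int N \<and> Q d c \<and>
    a * real_of_int c \<le> real_of_int d \<and> real_of_int d < b * real_of_int c}"

lemma finite_pts: "finite (pts Q a b N)"
proof (rule finite_subset)
  define M where "M = \<lceil>(\<bar>a\<bar> + \<bar>b\<bar>) * N\<rceil>"
  show "pts Q a b N \<subseteq> {- M..M} \<times> {1..int N}"
  proof
    fix x assume "x \<in> pts Q a b N"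
    then obtain d c where x: "x = (d, c)" "1 \<le> c" "c \<le> int N"
      "a * real_of_int c \<le> real_of_int d" "real_of_int d < b * real_of_int c"
      by (auto simp: pts_def)
    have "\<bar>a * c\<bar> \<le> \<bar>a\<bar> * N" "\<bar>b * c\<bar> \<le> \<bar>b\<bar> * N"
      using x(2,3) by (auto simp: abs_mult intro!: mult_left_mono)
    moreover have "0 \<le> \<bar>a\<bar> * N" "0 \<le> \<bar>b\<bar> * N" by simp_all
    ultimately have "\<bar>real_of_int d\<bar> \<le> \<bar>a\<bar> * N + \<bar>b\<bar> * N" using x(4,5) by linarith
    then have "\<bar>real_of_int d\<bar> \<le> M" unfolding M_def distrib_right by linarith
    then show "x \<in> {- M..M} \<times> {1..int N}" using x by auto
  qed
qed simp

lemma sum_pts_split: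
  assumes "a \<le> x" "x \<le> b"
  shows "(\<Sum>z\<in>pts Q a b N. f z) = (\<Sum>z\<in>pts Q a x N. f z) + (\<Sum>z\<in>pts Q x b N. f z)"
proof -
  have le: "a * real_of_int c \<le> x * real_of_int c" "x * real_of_int c \<le> b * real_of_int c"
    if "1 \<le> c" for c :: int
    using assms that by (auto intro!: mult_right_mono)
  have "pts Q a b N = pts Q a x N \<union> pts Q x b N"
  proof (intro set_eqI iffI)
    fix z assume "z \<in> pts Q a b N"
    then show "z \<in> pts Q a x N \<union> pts Q x b N" by (auto simp: pts_def)
  next
    fix z assume "z \<in> pts Q a x N \<union> pts Q x b N"
    then show "z \<in> pts Q a b N" using le[of "snd z"]
      by (cases z) (auto simp: pts_def intro: order_trans[OF le(1)] less_le_trans[OF _ le(2)])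
  qed
  moreover have "pts Q a x N \<inter> pts Q x b N = {}"
    by (auto simp: pts_def)
  ultimately show ?thesis
    using finite_pts by (simp add: sum.union_disjoint)
qed

section \<open>Cancellation along chains\<close>

text \<open>Windows of length M peel off from the left without contributing, until at most M terms
  of size at most 1 remain.\<close>

lemma abs_sum_le_window:
  fixes g :: "int \<Rightarrow> real"
  assumes "M > 0" "\<And>x. x \<ge> lo \<Longrightarrow> (\<Sum>i = x..<x + M. g i) = 0" "\<And>i. \<bar>g i\<bar> \<le> 1"
  shows "\<bar>\<Sum>i = lo..<hi. g i\<bar> \<le> of_int M"
  using assms(2)
proof (induction "nat (hi - lo)" arbitrary: lo rule: less_induct)
  case less
  show ?case
  proof (cases "hi - lo \<le> M")
    case True
    have "\<bar>\<Sum>i = lo..<hi. g i\<bar> \<le> (\<Sum>i = lo..<hi. 1)"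
      using assms(3) by (intro order_trans[OF sum_abs] sum_mono) auto
    then show ?thesis using True assms(1) by (cases "lo \<le> hi") simp_all
  next
    case False
    have "{lo..<hi} = {lo..<lo + M} \<union> {lo + M..<hi}" using False assms(1) by auto
    then have "(\<Sum>i = lo..<hi. g i) = (\<Sum>i = lo..<lo + M. g i) + (\<Sum>i = lo + M..<hi. g i)"
      by (simp add: sum.union_disjoint ivl_disj_int)
    then show ?thesis
      using less.hyps[of "lo + M"] less.prems assms(1) False by simp
  qed
qed

text \<open>Rearranges a window of length n t into t progressions of step t, the form in which
  consecutive values of S_4 appear.\<close>

lemma sum_blocks:
  fixes g :: "int \<Rightarrow> real"
  assumes "t > 0"
  shows "(\<Sum>i = x..<x + int n * t. g i) = (\<Sum>j<n. \<Sum>i = x..<x + t. g (i + int j * t))"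
proof (induction n)
  case (Suc n)
  have "{x..<x + int (Suc n) * t} = {x..<x + int n * t} \<union> {x + int n * t..<x + t + int n * t}"
  proof -
    have "0 \<le> int n * t" using assms by simp
    moreover have "x + int (Suc n) * t = x + t + int n * t" by (simp add: algebra_simps)
    ultimately have "x \<le> x + int n * t" "x + int n * t \<le> x + int (Suc n) * t"
      "x + int (Suc n) * t = x + t + int n * t" using assms by linarith+
    then show ?thesis using ivl_disj_un_two(3) by metis
  qed
  then have "(\<Sum>i = x..<x + int (Suc n) * t. g i) =
      (\<Sum>i = x..<x + int n * t. g i) + (\<Sum>i = x + int n * t..<x + t + int n * t. g i)"
    by (simp add: sum.union_disjoint ivl_disj_int)
  also have "(\<Sum>i = x + int n * t..<x + t + int n * t. g i) = (\<Sum>i = x..<x + t. g (i + int n * t))"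
    by (rule sum.reindex_bij_witness[of _ "\<lambda>i. i + int n * t" "\<lambda>i. i - int n * t"]) auto
  finally show ?case using Suc by simp
qed simp

text \<open>Models the deviation of a residue class modulo m from its expected share 1/m; see
  \<open>balanced_weight_residue\<close>. Any m consecutive values cancel.\<close>

locale balanced_weight =
  fixes m :: nat and w :: "int \<Rightarrow> real"
  assumes m_pos: "m > 0"
    and balanced: "(\<Sum>j<m. w (n + int j)) = 0"
    and bounded: "\<bar>w n\<bar> \<le> 1"
begin

text \<open>For odd t the move s \<mapsto> s + t preserves coprimality with t and raises S_4(t, s)
  by one, so m successive moves run through a balanced block. A window of m t consecutive s consists
  of t such blocks and has sum zero, and less than a full window costs at most m t.\<close>

lemma chain_sum_bound:
  assumes "odd t" "t > 0" "lo > 0"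
  shows "\<bar>\<Sum>s | s \<in> {lo..<hi} \<and> coprime t s. w (hardy_S4 t s + k)\<bar> \<le> real m * of_int t"
proof -
  define g where "g s = (if coprime t s then w (hardy_S4 t s + k) else 0)" for s
  have "(\<Sum>i = x..<x + int m * t. g i) = 0" if "x \<ge> lo" for x
  proof -
    have "(\<Sum>j<m. g (i + int j * t)) = 0" if "i > 0" for i
    proof -
      have "coprime t (i + int j * t) \<longleftrightarrow> coprime t i" for j
        by (metis coprime_iff_gcd_eq_1 gcd_add_mult add.commute)
      then have "g (i + int j * t) = (if coprime t i then w (hardy_S4 t i + k + int j) else 0)" for j
        using hardy_S4_add_mult[OF assms(1,2) that, of j] by (simp add: g_def algebra_simps)
      then show ?thesis using balanced[of "hardy_S4 t i + k"] by (cases "coprime t i") simp_all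
    qed
    then show ?thesis
      using that assms(3) unfolding sum_blocks[OF assms(2)] by (subst sum.swap) simp
  qed
  then have "\<bar>\<Sum>i = lo..<hi. g i\<bar> \<le> of_int (int m * t)"
    using assms(2) m_pos bounded by (intro abs_sum_le_window) (auto simp: g_def)
  moreover have "(\<Sum>i = lo..<hi. g i) =
      (\<Sum>s | s \<in> {lo..<hi} \<and> coprime t s. w (hardy_S4 t s + k))"
    unfolding g_def by (rule sum.inter_filter[symmetric]) simp
  ultimately show ?thesis by simp
qed

abbreviation "odd_coprime \<equiv> (\<lambda>d c. odd d \<and> coprime d c)"

definition wsum :: "real \<Rightarrow> real \<Rightarrow> nat \<Rightarrow> real" where
  "wsum a b N = (\<Sum>(d, c)\<in>pts odd_coprime a b N. w (hardy_S4 d c))"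

text \<open>
  In the basis \<open>(p', q')\<close>, \<open>(p, q)\<close> a point has coordinates \<open>t = dq - cp\<close> and \<open>s\<close>; adding \<open>t\<close> to \<open>s\<close>
  raises \<open>S\<^sub>4\<close> by one, so for each of the at most \<open>\<epsilon>N/q\<close> values of \<open>t\<close> the sum over \<open>s\<close> is bounded
  by \<open>m t\<close>.
\<close>

lemma strip_bound:
  fixes p q :: int and e :: real
  assumes "p \<ge> 0" "q > 0" "even p" "coprime p q" "0 < e" "e \<le> 1"
  shows "\<bar>wsum (p / q) (p / q + e / (real_of_int q)\<^sup>2) N\<bar> \<le> real m * (e * real N / q)\<^sup>2"
proof -
  obtain u v where uv: "u * p + v * q = 1"
    using assms(4) bezout_int[of p q] by (auto simp: coprime_iff_gcd_eq_1)
  \<comment> \<open>q' is the inverse of - p modulo q, which makes 1 + q' p divisible by q and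
    yields p' with determinant one. The reduced representative, with q' < q, is needed for the sign
    of s below.\<close>
  define q' where "q' = (- u) mod q"
  have q': "0 \<le> q'" "q' < q" using assms(2) by (auto simp: q'_def)
  have "q dvd 1 + q' * p"
  proof -
    have "q dvd q' + u" unfolding q'_def by (metis add.inverse_inverse diff_minus_eq_add mod_eq_dvd_iff mod_mod_trivial)
    then have "q dvd (q' + u) * p + v * q" by simp
    moreover have "(q' + u) * p + v * q = 1 + q' * p" using uv by (simp add: algebra_simps)
    ultimately show ?thesis by simp
  qed
  then obtain p' where "1 + q' * p = q * p'" by (elim dvdE)
  then have det: "p' * q - q' * p = 1" by (simp add: algebra_simps)
  have "p' * q > 0" using det q' assms by (smt (verit) mult_nonneg_nonneg)
  then have "p' \<ge> 0" using assms(2) by (simp add: zero_less_mult_iff)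
  have "p' * q = 1 + q' * p" using det by simp
  then have "odd (p' * q)" using assms(3) by simp
  then have "odd p'" by simp
  obtain k where k: "hardy_S4 (t * p' + s * p) (t * q' + s * q) = hardy_S4 t s + k"
    if "s > 0" "t > 0" "odd t" "coprime t s" for s t
    using hardy_S4_cone[OF assms(1) \<open>p' \<ge> 0\<close> assms(2) q'(1) assms(3) \<open>odd p'\<close> det] by auto
  define T where "T = \<lfloor>e * real N / q\<rfloor>"
  \<comment> \<open>For fixed t, the strip condition t q < e c and the bound c \<le> N, with c = t
    q' + s q, say exactly that s lies between \<open>lo t\<close> and \<open>hi t\<close>. The
    \<open>+ 1\<close> in \<open>lo\<close> reflects the strict inequality.\<close>
  define lo where "lo t = \<lfloor>(t * q / e - t * q') / q\<rfloor> + 1" for t :: int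
  define hi where "hi t = (int N - t * q') div q + 1" for t :: int
  \<comment> \<open>Since q' < q and e \<le> 1, every point of the strip has s > 0 and so lies in
    the open cone on which \<open>hardy_S4_cone\<close> holds.\<close>
  have lo: "lo t > 0" if "t > 0" for t
  proof -
    have "real_of_int (t * q') \<le> real_of_int (t * q)" using that q' by (simp del: of_int_mult)
    also have "\<dots> \<le> t * q / e"
      using assms that by (simp add: pos_le_divide_eq mult_left_le)
    finally have "0 \<le> (t * q / e - t * q') / q" using assms(2) by simp
    then show ?thesis by (simp add: lo_def)
  qed
  have ivl: "s \<in> {lo t..<hi t} \<longleftrightarrow>
      t * q < e * (t * q' + s * q) \<and> t * q' + s * q \<le> int N" for s t :: int
  proof -
    have "lo t \<le> s \<longleftrightarrow> (t * q / e - t * q') / q < s"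
      unfolding lo_def by linarith
    also have "\<dots> \<longleftrightarrow> t * q < e * (t * q' + s * q)"
      using assms by (simp add: field_simps)
    finally have 1: "lo t \<le> s \<longleftrightarrow> t * q < e * (t * q' + s * q)" .
    have "s < hi t \<longleftrightarrow> s \<le> (int N - t * q') div q" by (auto simp: hi_def)
    also have "\<dots> \<longleftrightarrow> t * q' + s * q \<le> int N"
      using assms(2) by (simp add: le_div_iff_mult_le_int) linarith
    finally show ?thesis using 1 by simp
  qed
  let ?R = "SIGMA t:{t\<in>{1..T}. odd t}. {s. s \<in> {lo t..<hi t} \<and> coprime t s}"
  \<comment> \<open>The determinant is one, so Cramer's rule gives the inverse change of coordinates
    without denominators.\<close>
  have "wsum (p / q) (p / q + e / (real_of_int q)\<^sup>2) N =
      (\<Sum>(t, s)\<in>?R. w (hardy_S4 t s + k))"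
    unfolding wsum_def
  proof (rule sum.reindex_bij_witness[where
      i = "\<lambda>(t, s). (t * p' + s * p, t * q' + s * q)" and j = "\<lambda>(d, c). (d * q - c * p, c * p' - d * q')"])
    fix x assume x: "x \<in> ?R"
    obtain t s where ts: "x = (t, s)" "1 \<le> t" "t \<le> T" "odd t" "s \<in> {lo t..<hi t}" "coprime t s"
      using x by auto
    have c: "t * q' + s * q \<le> int N" "t * q < e * (t * q' + s * q)" using ivl ts(5) by auto
    have "s > 0" using lo[of t] ts by simp
    have tq: "(t * p' + s * p) * q - (t * q' + s * q) * p = t"
      "(t * q' + s * q) * p' - (t * p' + s * p) * q' = s"
    proof -
      have "(t * p' + s * p) * q - (t * q' + s * q) * p = t * (p' * q - q' * p)"
        "(t * q' + s * q) * p' - (t * p' + s * p) * q' = s * (p' * q - q' * p)"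
        by (simp_all add: algebra_simps)
      then show "(t * p' + s * p) * q - (t * q' + s * q) * p = t"
        "(t * q' + s * q) * p' - (t * p' + s * p) * q' = s"
        by (simp_all add: det)
    qed
    then show "(\<lambda>(d, c). (d * q - c * p, c * p' - d * q'))
        ((\<lambda>(t, s). (t * p' + s * p, t * q' + s * q)) x) = x"
      by (simp add: ts)
    have pos: "t * q' + s * q > 0"
      using \<open>s > 0\<close> ts q' assms by (simp add: add_nonneg_pos)
    have "(t * q' + s * q) * p \<le> (t * p' + s * p) * q" using tq ts by linarith
    then have 1: "real_of_int p / q * (t * q' + s * q) \<le> t * p' + s * p"
      using assms(2) by (simp add: field_simps flip: of_int_mult of_int_add)
    have "real_of_int (t * p' + s * p) * q = (t * q' + s * q) * p + t"
      using tq(1) by (simp flip: of_int_mult of_int_add)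
    then have "real_of_int (t * p' + s * p) * q * q = (t * q' + s * q) * p * q + t * q"
      by (simp add: algebra_simps)
    then have "real_of_int (t * p' + s * p) * q * q < (t * q' + s * q) * p * q + e * (t * q' + s * q)"
      using c by simp
    then have 2: "real_of_int (t * p' + s * p) < (p / q + e / (real_of_int q)\<^sup>2) * (t * q' + s * q)"
      using assms(2) by (simp add: field_simps power2_eq_square)
    show "(\<lambda>(t, s). (t * p' + s * p, t * q' + s * q)) x
        \<in> pts odd_coprime (p / q) (p / q + e / (real_of_int q)\<^sup>2) N"
      using 1 2 pos c ts \<open>odd p'\<close> assms(3) coprime_unimodular_combination[of p' q p q' t s] det
      by (simp add: pts_def mult.commute)
  next
    fix x assume "x \<in> pts odd_coprime (p / q) (p / q + e / (real_of_int q)\<^sup>2) N"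
    then obtain d c where x: "x = (d, c)" "1 \<le> c" "c \<le> int N" "odd d" "coprime d c"
      "p / q * c \<le> d" "d < (p / q + e / (real_of_int q)\<^sup>2) * c" by (auto simp: pts_def)
    define t s where "t = d * q - c * p" and "s = c * p' - d * q'"
    have "t * p' + s * p = d * (p' * q - q' * p)" "t * q' + s * q = c * (p' * q - q' * p)"
      by (simp_all add: t_def s_def algebra_simps)
    then have dc: "t * p' + s * p = d" "t * q' + s * q = c" by (simp_all add: det)
    then show "(\<lambda>(t, s). (t * p' + s * p, t * q' + s * q)) ((\<lambda>(d, c). (d * q - c * p, c * p' - d * q')) x) = x"
      by (simp add: x t_def s_def)
    \<comment> \<open>As p is even, t inherits the parity of d. This also gives t \<noteq> 0, so no
      point lies on the left edge p/q of the strip.\<close>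
    have "odd (t * p' + s * p)" unfolding dc(1) by fact
    then have "odd t" using assms(3) by simp
    have "real_of_int (c * p) \<le> d * q" using x(6) assms(2) by (simp add: field_simps)
    then have "t \<ge> 0" unfolding t_def by linarith
    then have "t > 0" using \<open>odd t\<close> by (cases "t = 0") auto
    have "coprime t s"
    proof (rule coprimeI)
      fix g assume "g dvd t" "g dvd s"
      then have "g dvd t * p' + s * p" "g dvd t * q' + s * q" by simp_all
      then have "g dvd d" "g dvd c" unfolding dc .
      then show "is_unit g" using x(5) coprime_common_divisor by blast
    qed
    have "real_of_int d * q * q < c * p * q + e * c"
      using x(7) assms(2) by (simp add: field_simps power2_eq_square)
    moreover have "real_of_int (t * q) = real_of_int d * q * q - real_of_int (c * p * q)"
      by (simp add: t_def algebra_simps)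
    ultimately have tq: "t * q < e * c" by linarith
    have "s \<in> {lo t..<hi t}" unfolding ivl dc(2) using tq x by simp
    moreover have "t \<le> T"
    proof -
      have "e * c \<le> e * N" using x assms by (intro mult_left_mono) auto
      then have "real_of_int t \<le> e * N / q" using tq assms(2) by (simp add: pos_le_divide_eq)
      then show ?thesis by (simp add: T_def le_floor_iff)
    qed
    ultimately have "(t, s) \<in> ?R" using \<open>t > 0\<close> \<open>odd t\<close> \<open>coprime t s\<close> by auto
    then show "(\<lambda>(d, c). (d * q - c * p, c * p' - d * q')) x \<in> ?R" by (simp add: x t_def s_def)
    have "s > 0" using \<open>s \<in> _\<close> lo[OF \<open>t > 0\<close>] by simp
    from k[OF this \<open>t > 0\<close> \<open>odd t\<close> \<open>coprime t s\<close>]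
    have "hardy_S4 d c = hardy_S4 t s + k" by (simp add: dc)
    then show "(case (\<lambda>(d, c). (d * q - c * p, c * p' - d * q')) x of (t, s) \<Rightarrow> w (hardy_S4 t s + k)) =
        (case x of (d, c) \<Rightarrow> w (hardy_S4 d c))"
      by (simp add: x t_def s_def)
  qed
  also have "\<dots> = (\<Sum>t | t \<in> {1..T} \<and> odd t. \<Sum>s | s \<in> {lo t..<hi t} \<and> coprime t s. w (hardy_S4 t s + k))"
  proof (rule sum.Sigma[symmetric])
    show "finite {t. t \<in> {1..T} \<and> odd t}" by (rule finite_subset[of _ "{1..T}"]) auto
    show "\<forall>t\<in>{t. t \<in> {1..T} \<and> odd t}. finite {s. s \<in> {lo t..<hi t} \<and> coprime t s}"
      by (intro ballI finite_subset[OF Collect_restrict]) auto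
  qed
  finally have "\<bar>wsum (p / q) (p / q + e / (real_of_int q)\<^sup>2) N\<bar> =
      \<bar>\<Sum>t | t \<in> {1..T} \<and> odd t. \<Sum>s | s \<in> {lo t..<hi t} \<and> coprime t s. w (hardy_S4 t s + k)\<bar>"
    by (simp only:)
  also have "\<dots> \<le> (\<Sum>t | t \<in> {1..T} \<and> odd t. real m * of_int T)"
  proof (rule order_trans[OF sum_abs], rule sum_mono)
    fix t assume t: "t \<in> {t. t \<in> {1..T} \<and> odd t}"
    have "\<bar>\<Sum>s | s \<in> {lo t..<hi t} \<and> coprime t s. w (hardy_S4 t s + k)\<bar> \<le> real m * of_int t"
      using t lo by (intro chain_sum_bound) auto
    also have "\<dots> \<le> real m * of_int T" using t by (intro mult_left_mono) auto
    finally show "\<bar>\<Sum>s | s \<in> {lo t..<hi t} \<and> coprime t s. w (hardy_S4 t s + k)\<bar> \<le> real m * of_int T" .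
  qed
  also have "\<dots> \<le> of_int T * (real m * of_int T)"
  proof -
    have T0: "T \<ge> 0" using assms by (simp add: T_def)
    have "card {t. t \<in> {1..T} \<and> odd t} \<le> card {1..T}" by (intro card_mono) auto
    then have "real (card {t. t \<in> {1..T} \<and> odd t}) \<le> of_int T" using T0 by simp
    then show ?thesis using T0 by (simp add: mult_right_mono)
  qed
  also have "\<dots> = real m * (of_int T)\<^sup>2" by (simp add: power2_eq_square)
  also have "\<dots> \<le> real m * (e * real N / q)\<^sup>2"
  proof (intro mult_left_mono power_mono)
    show "0 \<le> real_of_int T" using assms by (simp add: T_def)
    show "real_of_int T \<le> e * real N / q" unfolding T_def by linarith
  qed simp
  finally show ?thesis .
qed

end

subsection \<open>Counting fractions\<close>

text \<open>\<mu> / (1 - \<theta>) is the fixed point of K \<mapsto> \<theta> K + \<mu>, and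
  iteration approaches it geometrically. This serves both the counting error in
  \<open>odd_deconvolution\<close> and the imbalance in \<open>density_bound_small\<close>.\<close>

lemma contraction_limit:
  fixes B :: "real \<Rightarrow> bool"
  assumes "B K" "\<And>K. B K \<Longrightarrow> B (\<theta> * K + \<mu>)" "\<And>K L. B K \<Longrightarrow> K \<le> L \<Longrightarrow> B L"
    and "0 \<le> \<theta>" "\<theta> < 1" "\<delta> > 0"
  shows "B (\<mu> / (1 - \<theta>) + \<delta>)"
proof -
  define L where "L = \<mu> / (1 - \<theta>)"
  have L: "\<theta> * L + \<mu> = L" using assms(5) by (simp add: L_def field_simps)
  have B: "B (L + \<theta> ^ n * (K - L))" for n
  proof (induction n)
    case (Suc n)
    have "\<theta> * (L + \<theta> ^ n * (K - L)) + \<mu> = (\<theta> * L + \<mu>) + \<theta> ^ Suc n * (K - L)"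
      by (simp add: algebra_simps)
    then show ?case using assms(2)[OF Suc] by (simp only: L)
  qed (simp add: assms(1))
  have "(\<lambda>n. \<theta> ^ n * (K - L)) \<longlonglongrightarrow> 0"
    using assms(4,5) by (intro tendsto_mult_left_zero LIMSEQ_power_zero) auto
  then obtain n where "\<theta> ^ n * (K - L) < \<delta>"
    using order_tendstoD(2)[OF _ assms(6)] eventually_happens'[OF sequentially_bot] by blast
  then show ?thesis using assms(3)[OF B[of n]] by (simp add: L_def)
qed

text \<open>(2k + 1)^2 \<ge> 4 k (k + 1), so the sum is dominated by a telescoping one with total
  1/4. That this is less than 1 makes the deconvolution a contraction.\<close>

lemma sum_inverse_odd_squares:
  "(\<Sum>e | e \<in> {3..N} \<and> odd e. 1 / (real e)\<^sup>2) \<le> 1 / 4"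
proof -
  have "(\<Sum>k = 1..n. 1 / (real (2 * k + 1))\<^sup>2) \<le> 1 / 4 - 1 / (4 * (real n + 1))" for n :: nat
  proof (induction n)
    case (Suc n)
    have "1 / (real (2 * Suc n + 1))\<^sup>2 \<le> 1 / (4 * (real n + 1)) - 1 / (4 * (real n + 2))"
    proof -
      have "1 / (4 * (real n + 1)) - 1 / (4 * (real n + 2)) = 1 / (4 * (real n + 1) * (real n + 2))"
        by (simp add: divide_simps)
      moreover have "4 * (real n + 1) * (real n + 2) \<le> (real (2 * Suc n + 1))\<^sup>2"
        by (simp add: power2_eq_square algebra_simps)
      ultimately show ?thesis by (simp add: frac_le)
    qed
    then show ?case using Suc by (simp add: add_ac)
  qed simp
  note * = this
  have "(\<Sum>e | e \<in> {3..N} \<and> odd e. 1 / (real e)\<^sup>2) \<le> (\<Sum>e \<in> (\<lambda>k. 2 * k + 1) ` {1..N}. 1 / (real e)\<^sup>2)"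
  proof (rule sum_mono2)
    show "{e. e \<in> {3..N} \<and> odd e} \<subseteq> (\<lambda>k. 2 * k + 1) ` {1..N}"
      by (auto elim!: oddE)
  qed auto
  also have "\<dots> = (\<Sum>k = 1..N. 1 / (real (2 * k + 1))\<^sup>2)"
    by (subst sum.reindex) (auto intro: inj_onI)
  also have "\<dots> \<le> 1 / 4 - 1 / (4 * (real N + 1))" by (rule *)
  also have "\<dots> \<le> 1 / 4" by simp
  finally show ?thesis .
qed

text \<open>
  No Moebius inversion is needed: the terms \<open>e \<ge> 3\<close> together carry weight at most \<open>1/4\<close>, so the term
  \<open>e = 1\<close> dominates and any quadratic bound for \<open>f\<close> improves itself by a factor 4.
\<close>

lemma odd_deconvolution:
  fixes f :: "nat \<Rightarrow> real"
  assumes bound: "\<And>n. \<bar>f n\<bar> \<le> C * (real n)\<^sup>2"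
    and lim: "(\<lambda>N. (\<Sum>e | e \<in> {1..N} \<and> odd e. f (N div e)) / (real N)\<^sup>2) \<longlonglongrightarrow> 0"
  shows "(\<lambda>n. f n / (real n)\<^sup>2) \<longlonglongrightarrow> 0"
proof -
  \<comment> \<open>\<open>B K\<close> expresses that the upper limit of |f n| / n^2 is at most
    K.\<close>
  define B where "B K \<longleftrightarrow> K \<ge> 0 \<and> (\<forall>\<delta>>0. \<forall>\<^sub>F n in sequentially. \<bar>f n\<bar> \<le> (K + \<delta>) * (real n)\<^sup>2)" for K
  have "C \<ge> 0" using bound[of 1] by (simp add: order_trans[OF abs_ge_zero])
  have "B C"
    unfolding B_def
  proof (intro conjI allI impI always_eventually)
    fix \<delta> :: real and n assume "\<delta> > 0"
    then show "\<bar>f n\<bar> \<le> (C + \<delta>) * (real n)\<^sup>2"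
      using bound[of n] by (simp add: distrib_right add_increasing2)
  qed fact
  moreover have "B (1 / 4 * K + 0)" if "B K" for K
    unfolding B_def
  proof (intro conjI allI impI)
    show "0 \<le> 1 / 4 * K + 0" using that by (simp add: B_def)
    fix \<delta> :: real assume \<delta>: "\<delta> > 0"
    then obtain n0 where n0: "\<bar>f n\<bar> \<le> (K + \<delta>) * (real n)\<^sup>2" if "n \<ge> n0" for n
      using \<open>B K\<close> unfolding B_def eventually_sequentially by blast
    have K: "K \<ge> 0" using that by (simp add: B_def)
    \<comment> \<open>For large e the argument N div e may stay below n0, where the eventual bound
      says nothing. An additive constant covers these terms, at a total cost linear in N.\<close>
    have f: "\<bar>f n\<bar> \<le> (K + \<delta>) * (real n)\<^sup>2 + C * (real n0)\<^sup>2" for n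
    proof (cases "n \<ge> n0")
      case True
      then show ?thesis using n0[of n] \<open>C \<ge> 0\<close> by (simp add: add_increasing2)
    next
      case False
      then have "C * (real n)\<^sup>2 \<le> C * (real n0)\<^sup>2"
        using \<open>C \<ge> 0\<close> by (intro mult_left_mono power_mono) auto
      then show ?thesis using bound[of n] K \<delta> by (simp add: add_increasing)
    qed
    have step: "\<bar>f N\<bar> \<le> \<bar>\<Sum>e | e \<in> {1..N} \<and> odd e. f (N div e)\<bar> + (K + \<delta>) / 4 * (real N)\<^sup>2
        + C * (real n0)\<^sup>2 * real N" if "N \<ge> 1" for N
    proof -
      have fin: "finite {e. e \<in> {3..N} \<and> odd e}" by simp
      have "{e. e \<in> {1..N} \<and> odd e} = insert 1 {e. e \<in> {3..N} \<and> odd e}"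
      proof -
        have "e = 1 \<or> e \<ge> 3" if "odd e" for e :: nat
          using that by (cases "e = 1") (auto elim!: oddE)
        then show ?thesis using \<open>N \<ge> 1\<close> by auto
      qed
      then have 1: "(\<Sum>e | e \<in> {1..N} \<and> odd e. f (N div e)) =
          f N + (\<Sum>e | e \<in> {3..N} \<and> odd e. f (N div e))"
        using fin by simp
      have "\<bar>\<Sum>e | e \<in> {3..N} \<and> odd e. f (N div e)\<bar>
          \<le> (\<Sum>e | e \<in> {3..N} \<and> odd e. (K + \<delta>) * (real N)\<^sup>2 * (1 / (real e)\<^sup>2) + C * (real n0)\<^sup>2)"
      proof (rule order_trans[OF sum_abs], rule sum_mono)
        fix e assume "e \<in> {e. e \<in> {3..N} \<and> odd e}"
        have "real (N div e) \<le> real N / real e" by (rule of_nat_div_le_of_nat)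
        then have "(real (N div e))\<^sup>2 \<le> (real N / real e)\<^sup>2" by (intro power_mono) auto
        then have "(K + \<delta>) * (real (N div e))\<^sup>2 \<le> (K + \<delta>) * (real N / real e)\<^sup>2"
          using K \<delta> by (intro mult_left_mono) auto
        then show "\<bar>f (N div e)\<bar> \<le> (K + \<delta>) * (real N)\<^sup>2 * (1 / (real e)\<^sup>2) + C * (real n0)\<^sup>2"
          using f[of "N div e"] by (simp add: power_divide)
      qed
      also have "\<dots> = (K + \<delta>) * (real N)\<^sup>2 * (\<Sum>e | e \<in> {3..N} \<and> odd e. 1 / (real e)\<^sup>2)
          + real (card {e. e \<in> {3..N} \<and> odd e}) * (C * (real n0)\<^sup>2)"
        by (simp add: sum.distrib sum_distrib_left)
      also have "\<dots> \<le> (K + \<delta>) * (real N)\<^sup>2 * (1 / 4) + real N * (C * (real n0)\<^sup>2)"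
      proof (intro add_mono mult_left_mono mult_right_mono sum_inverse_odd_squares)
        have "card {e. e \<in> {3..N} \<and> odd e} \<le> card {3..N}" by (intro card_mono) auto
        then show "real (card {e. e \<in> {3..N} \<and> odd e}) \<le> real N" by simp
      qed (use K \<delta> \<open>C \<ge> 0\<close> in auto)
      finally have "\<bar>\<Sum>e | e \<in> {3..N} \<and> odd e. f (N div e)\<bar>
          \<le> (K + \<delta>) * (real N)\<^sup>2 * (1 / 4) + real N * (C * (real n0)\<^sup>2)" .
      then have "\<bar>f N\<bar> \<le> \<bar>\<Sum>e | e \<in> {1..N} \<and> odd e. f (N div e)\<bar>
          + ((K + \<delta>) * (real N)\<^sup>2 * (1 / 4) + real N * (C * (real n0)\<^sup>2))"
        unfolding 1 by linarith
      then show ?thesis by (simp add: algebra_simps add_divide_distrib)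
    qed
    have "\<forall>\<^sub>F N in sequentially. \<bar>(\<Sum>e | e \<in> {1..N} \<and> odd e. f (N div e)) / (real N)\<^sup>2\<bar> < \<delta> / 4"
      using tendsto_rabs_zero[OF lim] \<delta> by (intro order_tendstoD(2)) auto
    moreover have "\<forall>\<^sub>F N in sequentially. C * (real n0)\<^sup>2 * inverse (real N) < \<delta> / 4"
      using tendsto_mult_right_zero[OF lim_inverse_n] \<delta> by (intro order_tendstoD(2)) auto
    ultimately show "\<forall>\<^sub>F n in sequentially. \<bar>f n\<bar> \<le> (1 / 4 * K + 0 + \<delta>) * (real n)\<^sup>2"
      using eventually_ge_at_top[of 1]
    proof eventually_elim
      case (elim N)
      have "\<bar>\<Sum>e | e \<in> {1..N} \<and> odd e. f (N div e)\<bar> \<le> \<delta> / 4 * (real N)\<^sup>2"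
        using elim(1,3) by (simp add: pos_divide_less_eq)
      moreover have "C * (real n0)\<^sup>2 * real N \<le> \<delta> / 4 * (real N)\<^sup>2"
        using elim(2,3) by (simp add: field_simps power2_eq_square)
      ultimately have "\<bar>f N\<bar> \<le> (\<delta> / 4 + (K + \<delta>) / 4 + \<delta> / 4) * (real N)\<^sup>2"
        using step[OF elim(3)] by (simp add: algebra_simps)
      also have "\<dots> \<le> (1 / 4 * K + 0 + \<delta>) * (real N)\<^sup>2"
      proof (rule mult_right_mono)
        show "\<delta> / 4 + (K + \<delta>) / 4 + \<delta> / 4 \<le> 1 / 4 * K + 0 + \<delta>" using \<delta> by argo
      qed simp
      finally show ?case .
    qed
  qed
  moreover have "B L" if "B K" "K \<le> L" for K L
    unfolding B_def
  proof (intro conjI allI impI)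
    show "0 \<le> L" using that by (simp add: B_def)
    fix \<delta> :: real assume "\<delta> > 0"
    then have "\<forall>\<^sub>F n in sequentially. \<bar>f n\<bar> \<le> (K + \<delta>) * (real n)\<^sup>2" using that by (simp add: B_def)
    then show "\<forall>\<^sub>F n in sequentially. \<bar>f n\<bar> \<le> (L + \<delta>) * (real n)\<^sup>2"
    proof eventually_elim
      case (elim n)
      have "(K + \<delta>) * (real n)\<^sup>2 \<le> (L + \<delta>) * (real n)\<^sup>2" using that by (intro mult_right_mono) auto
      then show ?case using elim by linarith
    qed
  qed
  ultimately have B: "B \<delta>" if "\<delta> > 0" for \<delta>
    using contraction_limit[of B C "1 / 4" 0 \<delta>] that by simp
  show ?thesis
  proof (rule tendstoI)
    fix \<epsilon> :: real assume \<epsilon>: "\<epsilon> > 0"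
    then have "\<forall>\<^sub>F n in sequentially. \<bar>f n\<bar> \<le> (\<epsilon> / 4 + \<epsilon> / 4) * (real n)\<^sup>2"
      using B[of "\<epsilon> / 4"] unfolding B_def by (meson divide_pos_pos zero_less_numeral)
    then show "\<forall>\<^sub>F n in sequentially. dist (f n / (real n)\<^sup>2) 0 < \<epsilon>"
      using eventually_gt_at_top[of 0]
    proof eventually_elim
      case (elim n)
      then have "\<bar>f n\<bar> / (real n)\<^sup>2 \<le> \<epsilon> / 2" by (simp add: pos_divide_le_eq)
      moreover have "dist (f n / (real n)\<^sup>2) 0 = \<bar>f n\<bar> / (real n)\<^sup>2" by simp
      ultimately show ?case using \<epsilon> by linarith
    qed
  qed
qed

section \<open>Coprime pairs with parity conditions in sectors\<close>

text \<open>This is (1 - 1/4) \<zeta>(2) = \<pi>^2 / 8. It cancels when densities are divided in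
  \<open>hardy_S4_residue_density\<close>.\<close>

definition odd_zeta :: real where
  "odd_zeta = (\<Sum>e. if odd e then 1 / (real e)\<^sup>2 else 0)"

text \<open>Each quotient (N div e) / N tends to 1/e and vanishes for e > N, so the sum extends to a
  series over all e with majorant 1/e^2, and Tannery's theorem exchanges limit and sum.\<close>

lemma sum_odd_div_squares:
  "(\<lambda>N. (\<Sum>e | e \<in> {1..N} \<and> odd e. (real (N div e))\<^sup>2) / (real N)\<^sup>2) \<longlonglongrightarrow> odd_zeta"
  and odd_zeta_pos: "odd_zeta > 0"
proof -
  define a where "a e N = (if odd e then (real (N div e))\<^sup>2 / (real N)\<^sup>2 else 0)" for e N :: nat
  define b where "b e = (if odd e then 1 / (real e)\<^sup>2 else 0)" for e :: nat
  have sb: "summable (\<lambda>e. 1 / (real e)\<^sup>2)"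
    using inverse_power_summable[of 2, where 'a = real] by (simp add: inverse_eq_divide)
  have lim: "(\<lambda>N. a e N) \<longlonglongrightarrow> b e" for e
  proof (cases "odd e")
    case True
    then have e: "e > 0" by (cases e) auto
    have "(\<lambda>N. real (N div e) / real N) \<longlonglongrightarrow> 1 / real e"
    proof (rule tendsto_sandwich)
      show "\<forall>\<^sub>F N in sequentially. 1 / real e - 1 / real N \<le> real (N div e) / real N"
        using eventually_gt_at_top[of 0]
      proof eventually_elim
        case (elim N)
        have "real N / real e - 1 \<le> real (N div e)"
          using floor_divide_of_nat_eq[where 'a = real, of N e] by linarith
        then have "(real N / real e - 1) / real N \<le> real (N div e) / real N"
          by (intro divide_right_mono) auto
        then show ?case using elim by (simp add: diff_divide_distrib)
      qed
      show "\<forall>\<^sub>F N in sequentially. real (N div e) / real N \<le> 1 / real e"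
        using eventually_gt_at_top[of 0]
      proof eventually_elim
        case (elim N)
        have "real (N div e) / real N \<le> (real N / real e) / real N"
          by (intro divide_right_mono of_nat_div_le_of_nat) auto
        then show ?case using elim by simp
      qed
      have "(\<lambda>N. 1 / real e - 1 / real N) \<longlonglongrightarrow> 1 / real e - 0"
        by (intro tendsto_diff tendsto_const lim_1_over_n)
      then show "(\<lambda>N. 1 / real e - 1 / real N) \<longlonglongrightarrow> 1 / real e" by simp
    qed simp
    then have "(\<lambda>N. (real (N div e) / real N)\<^sup>2) \<longlonglongrightarrow> (1 / real e)\<^sup>2" by (rule tendsto_power)
    then show ?thesis using True by (simp add: a_def b_def power_divide)
  qed (simp add: a_def b_def)
  have bound: "norm (a e N) \<le> 1 / (real e)\<^sup>2" for e N
  proof (cases "N = 0")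
    case False
    have "(real (N div e))\<^sup>2 / (real N)\<^sup>2 \<le> (real N / real e)\<^sup>2 / (real N)\<^sup>2"
      by (intro divide_right_mono power_mono of_nat_div_le_of_nat) auto
    then show ?thesis using False by (simp add: a_def power_divide)
  qed (simp add: a_def)
  have "(\<lambda>N. suminf (\<lambda>e. a e N)) \<longlonglongrightarrow> suminf b"
    using tannerys_theorem[OF lim always_eventually sb] bound by auto
  moreover have "suminf (\<lambda>e. a e N) = (\<Sum>e | e \<in> {1..N} \<and> odd e. (real (N div e))\<^sup>2) / (real N)\<^sup>2" for N
  proof -
    have "suminf (\<lambda>e. a e N) = (\<Sum>e | e \<in> {1..N} \<and> odd e. a e N)"
    proof (rule suminf_finite)
      fix e assume "e \<notin> {e. e \<in> {1..N} \<and> odd e}"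
      then show "a e N = 0" by (cases "e = 0") (auto simp: a_def)
    qed simp
    also have "\<dots> = (\<Sum>e | e \<in> {1..N} \<and> odd e. (real (N div e))\<^sup>2 / (real N)\<^sup>2)"
      by (intro sum.cong) (auto simp: a_def)
    finally show ?thesis by (simp add: sum_divide_distrib)
  qed
  ultimately show "(\<lambda>N. (\<Sum>e | e \<in> {1..N} \<and> odd e. (real (N div e))\<^sup>2) / (real N)\<^sup>2) \<longlonglongrightarrow> odd_zeta"
    by (simp add: odd_zeta_def b_def[abs_def])
  have "summable b"
    by (rule summable_comparison_test[OF _ sb]) (auto simp: b_def)
  then show "odd_zeta > 0"
    unfolding odd_zeta_def b_def by (rule suminf_pos2[of _ 1]) auto
qed

text \<open>Sort the points by e = gcd(d, c); division by e maps each class onto the coprime points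
  with denominator at most N div e. The hypothesis holds for the parity conditions considered here
  because they force one coordinate to be odd, hence an odd gcd.\<close>

lemma card_pts_gcd:
  assumes Q: "\<And>e d c. e \<ge> 1 \<Longrightarrow> Q (e * d) (e * c) \<longleftrightarrow> odd e \<and> Q d c"
  shows "card (pts Q a b N) =
    (\<Sum>e | e \<in> {1..N} \<and> odd e. card (pts (\<lambda>d c. Q d c \<and> coprime d c) a b (N div e)))"
proof -
  let ?g = "\<lambda>z :: int \<times> int. nat (gcd (fst z) (snd z))"
  have G: "(\<Sum>e | e \<in> {1..N} \<and> odd e. \<Sum>z | z \<in> pts Q a b N \<and> ?g z = e. 1) = (\<Sum>z\<in>pts Q a b N. 1 :: nat)"
  proof (rule sum.group)
    show "?g ` pts Q a b N \<subseteq> {e. e \<in> {1..N} \<and> odd e}"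
    proof
      fix e assume "e \<in> ?g ` pts Q a b N"
      then obtain d c where dc: "(d, c) \<in> pts Q a b N" "e = nat (gcd d c)" by auto
      have c: "1 \<le> c" "c \<le> int N" "Q d c" using dc by (auto simp: pts_def)
      have "gcd d c > 0" using c by simp
      have "gcd d c \<le> c" using c by (intro zdvd_imp_le) auto
      then have le: "gcd d c \<le> int N" using c by linarith
      have "odd (gcd d c)"
        using Q[of "gcd d c" "d div gcd d c" "c div gcd d c"] c \<open>gcd d c > 0\<close> by simp
      have eq: "int e = gcd d c" using dc(2) by simp
      with \<open>odd (gcd d c)\<close> have "odd e" by (metis even_of_nat)
      moreover have "int e > 0" "int e \<le> int N" using eq le \<open>gcd d c > 0\<close> by linarith+
      ultimately have "int e > 0" "int e \<le> int N" "odd e" by blast+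
      then show "e \<in> {e. e \<in> {1..N} \<and> odd e}" by simp
    qed
  qed (use finite_pts in auto)
  have F: "(\<Sum>z | z \<in> pts Q a b N \<and> ?g z = e. 1) =
      card (pts (\<lambda>d c. Q d c \<and> coprime d c) a b (N div e))" if "e \<in> {e. e \<in> {1..N} \<and> odd e}" for e
  proof -
    have e: "e \<ge> 1" "odd e" using that by auto
    have "bij_betw (\<lambda>(d, c). (int e * d, int e * c)) (pts (\<lambda>d c. Q d c \<and> coprime d c) a b (N div e))
        {z. z \<in> pts Q a b N \<and> ?g z = e}"
    proof (rule bij_betw_byWitness[where f' = "\<lambda>(d, c). (d div int e, c div int e)"])
      have scale: "a * real_of_int (int e * c) \<le> real_of_int (int e * d) \<longleftrightarrow> a * c \<le> d"
        "real_of_int (int e * d) < b * real_of_int (int e * c) \<longleftrightarrow> d < b * c" for c d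
        using e by (simp_all add: mult.left_commute[of _ "real e"])
      have N: "int e * c \<le> int N \<longleftrightarrow> c \<le> int (N div e)" for c
        using e le_div_iff_mult_le_int[of "int e" c "int N"] by (simp add: zdiv_int mult.commute)
      show "(\<lambda>(d, c). (int e * d, int e * c)) ` pts (\<lambda>d c. Q d c \<and> coprime d c) a b (N div e)
          \<subseteq> {z \<in> pts Q a b N. ?g z = e}"
      proof
        fix z assume "z \<in> (\<lambda>(d, c). (int e * d, int e * c)) ` pts (\<lambda>d c. Q d c \<and> coprime d c) a b (N div e)"
        then obtain d c where dc: "z = (int e * d, int e * c)"
          "(d, c) \<in> pts (\<lambda>d c. Q d c \<and> coprime d c) a b (N div e)" by auto
        have "z \<in> pts Q a b N"
          using dc(2) scale[of c d] N[of c] e Q[of "int e" d c]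
          unfolding pts_def dc(1) by (simp add: int_one_le_iff_zero_less)
        moreover have "gcd (int e * d) (int e * c) = int e"
          using dc(2) by (simp add: gcd_mult_left pts_def)
        ultimately show "z \<in> {z \<in> pts Q a b N. ?g z = e}" by (simp add: dc(1))
      qed
      show "(\<lambda>(d, c). (d div int e, c div int e)) ` {z \<in> pts Q a b N. ?g z = e}
          \<subseteq> pts (\<lambda>d c. Q d c \<and> coprime d c) a b (N div e)"
      proof
        fix z assume "z \<in> (\<lambda>(d, c). (d div int e, c div int e)) ` {z \<in> pts Q a b N. ?g z = e}"
        then obtain d c where dc: "z = (d div int e, c div int e)" "(d, c) \<in> pts Q a b N" "nat (gcd d c) = e"
          by auto
        have g: "gcd d c = int e" using dc(3) e by linarith
        define d' c' where "d' = d div int e" and "c' = c div int e"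
        have "int e dvd d" "int e dvd c" using gcd_dvd1[of d c] gcd_dvd2[of d c] unfolding g .
        then have dc': "d = int e * d'" "c = int e * c'" by (simp_all add: d'_def c'_def)
        have "gcd d' c' = 1"
          using g e gcd_mult_left[of "int e" d' c'] unfolding dc' by simp
        then have "coprime d' c'" by (simp add: coprime_iff_gcd_eq_1)
        moreover have "c' \<ge> 1" using dc(2) e unfolding dc' pts_def by (auto simp: int_one_le_iff_zero_less zero_less_mult_iff)
        ultimately show "z \<in> pts (\<lambda>d c. Q d c \<and> coprime d c) a b (N div e)"
          using dc(2) scale[of c' d'] N[of c'] e Q[of "int e" d' c']
          unfolding dc(1) d'_def[symmetric] c'_def[symmetric] unfolding dc' by (simp add: pts_def)
      qed
    next
      show "\<forall>z\<in>{z. z \<in> pts Q a b N \<and> ?g z = e}. (\<lambda>(d, c). (int e * d, int e * c)) ((\<lambda>(d, c). (d div int e, c div int e)) z) = z"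
      proof
        fix z assume z: "z \<in> {z. z \<in> pts Q a b N \<and> ?g z = e}"
        obtain d c where "z = (d, c)" by (cases z)
        moreover have "gcd d c = int e" using z calculation e by auto
        then have "int e dvd d" "int e dvd c" by (metis gcd_dvd1, metis gcd_dvd2)
        ultimately show "(\<lambda>(d, c). (int e * d, int e * c)) ((\<lambda>(d, c). (d div int e, c div int e)) z) = z"
          by simp
      qed
    qed (use e in auto)
    then show ?thesis by (simp add: bij_betw_same_card)
  qed
  show ?thesis unfolding card_eq_sum[of "pts Q a b N"] G[symmetric] by (rule sum.cong[OF refl F])
qed

lemma card_residue_interval:
  fixes x y :: real and r :: int
  assumes "x \<le> y"
  shows "\<bar>real (card {d. d mod 2 = r mod 2 \<and> x \<le> real_of_int d \<and> real_of_int d < y}) - (y - x) / 2\<bar> \<le> 1"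
proof -
  define s where "s = r mod 2"
  have s: "s mod 2 = s" by (simp add: s_def)
  have "{d. d mod 2 = s \<and> x \<le> real_of_int d \<and> real_of_int d < y} =
      (\<lambda>j. 2 * j + s) ` {\<lceil>(x - s) / 2\<rceil>..<\<lceil>(y - s) / 2\<rceil>}"
  proof (intro set_eqI iffI)
    fix d assume d: "d \<in> {d. d mod 2 = s \<and> x \<le> real_of_int d \<and> real_of_int d < y}"
    define j where "j = d div 2"
    have "d = 2 * j + s" using d mult_div_mod_eq[of 2 d] by (simp add: j_def)
    moreover from this have "j \<in> {\<lceil>(x - s) / 2\<rceil>..<\<lceil>(y - s) / 2\<rceil>}"
      using d by (simp add: ceiling_le_iff less_ceiling_iff)
    ultimately show "d \<in> (\<lambda>j. 2 * j + s) ` {\<lceil>(x - s) / 2\<rceil>..<\<lceil>(y - s) / 2\<rceil>}" by blast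
  next
    fix d assume "d \<in> (\<lambda>j. 2 * j + s) ` {\<lceil>(x - s) / 2\<rceil>..<\<lceil>(y - s) / 2\<rceil>}"
    then obtain j where "d = 2 * j + s" "(x - s) / 2 \<le> j" "j < (y - s) / 2"
      by (auto simp: ceiling_le_iff less_ceiling_iff)
    then show "d \<in> {d. d mod 2 = s \<and> x \<le> real_of_int d \<and> real_of_int d < y}"
      using s by (auto simp: field_simps mod_add_right_eq mod_mult_self2)
  qed
  then have "card {d. d mod 2 = s \<and> x \<le> real_of_int d \<and> real_of_int d < y} =
      nat (\<lceil>(y - s) / 2\<rceil> - \<lceil>(x - s) / 2\<rceil>)"
    by (simp add: card_image inj_on_def)
  moreover have "\<lceil>(x - s) / 2\<rceil> \<le> \<lceil>(y - s) / 2\<rceil>" using assms by (intro ceiling_mono) auto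
  ultimately have "real (card {d. d mod 2 = s \<and> x \<le> real_of_int d \<and> real_of_int d < y}) =
      real_of_int \<lceil>(y - s) / 2\<rceil> - real_of_int \<lceil>(x - s) / 2\<rceil>"
    by simp
  moreover have "(y - s) / 2 - (x - s) / 2 = (y - x) / 2" by (simp add: field_simps)
  ultimately show ?thesis unfolding s_def[symmetric] by linarith
qed

text \<open>Count row by row: a fixed denominator c allows numerators of one parity in an interval
  of length (b - a) c, which is (b - a) c / 2 up to an error 1, and there are at most N rows.
  \<open>R\<close> is the condition on c.\<close>

lemma card_pts_approx:
  assumes "a \<le> b" "\<And>d c. Q d c \<longleftrightarrow> d mod 2 = r mod 2 \<and> R c"
  shows "\<bar>real (card (pts Q a b N)) - (b - a) / 2 * (\<Sum>c | c \<in> {1..int N} \<and> R c. real_of_int c)\<bar> \<le> real N"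
proof -
  define F where "F c = {d. d mod 2 = r mod 2 \<and> a * c \<le> real_of_int d \<and> real_of_int d < b * c}" for c :: int
  have fin: "finite (F c)" for c
    by (rule finite_subset[of _ "{\<lfloor>a * c\<rfloor>..\<lceil>b * c\<rceil>}"]) (auto simp: F_def, linarith+)
  have "pts Q a b N = (\<lambda>(c, d). (d, c)) ` (SIGMA c:{c. c \<in> {1..int N} \<and> R c}. F c)"
    using assms(2) by (auto simp: pts_def F_def image_iff)
  moreover have "inj_on (\<lambda>(c, d). (d, c)) (SIGMA c:{c. c \<in> {1..int N} \<and> R c}. F c)"
    by (auto intro: inj_onI)
  moreover have "finite {c. c \<in> {1..int N} \<and> R c}"
    by (rule finite_subset[of _ "{1..int N}"]) auto
  ultimately have "card (pts Q a b N) = (\<Sum>c | c \<in> {1..int N} \<and> R c. card (F c))"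
    using fin card_SigmaI[of "{c. c \<in> {1..int N} \<and> R c}" F] by (simp only: card_image) blast
  then have "real (card (pts Q a b N)) - (b - a) / 2 * (\<Sum>c | c \<in> {1..int N} \<and> R c. real_of_int c)
      = (\<Sum>c | c \<in> {1..int N} \<and> R c. real (card (F c)) - (b * c - a * c) / 2)"
  proof -
    have "(b * c - a * c) / 2 = (b - a) / 2 * c" for c :: int by (simp add: field_simps)
    then show ?thesis
      using \<open>card (pts Q a b N) = _\<close> by (simp only: sum_subtractf sum_distrib_left of_nat_sum)
  qed
  also have "\<bar>\<dots>\<bar> \<le> (\<Sum>c | c \<in> {1..int N} \<and> R c. 1)"
  proof (rule order_trans[OF sum_abs], rule sum_mono)
    fix c assume "c \<in> {c. c \<in> {1..int N} \<and> R c}"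
    then have "a * c \<le> b * c" using assms(1) by (intro mult_right_mono) auto
    then show "\<bar>real (card (F c)) - (b * c - a * c) / 2\<bar> \<le> 1"
      unfolding F_def by (rule card_residue_interval)
  qed
  also have "\<dots> \<le> real N"
  proof -
    have "card {c. c \<in> {1..int N} \<and> R c} \<le> card {1..int N}" by (intro card_mono) auto
    then show ?thesis by simp
  qed
  finally show ?thesis .
qed

text \<open>The count without coprimality is the sum over odd e of the coprime counts L(N div e). If
  L(N) were \<kappa> N^2, this sum would be asymptotic to \<kappa> \<open>odd_zeta\<close> N^2, and
  comparison with (b - a) \<sigma> / 2 determines \<kappa>. For L(N) - \<kappa> N^2 the sums are
  then o(N^2), and the deconvolution applies.\<close>

lemma card_coprime_pts_limit:
  assumes "a \<le> b" "\<And>d c. Q d c \<longleftrightarrow> d mod 2 = r mod 2 \<and> R c"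
    and "\<And>e d c. e \<ge> 1 \<Longrightarrow> Q (e * d) (e * c) \<longleftrightarrow> odd e \<and> Q d c"
    and "(\<lambda>N. (\<Sum>c | c \<in> {1..int N} \<and> R c. real_of_int c) / (real N)\<^sup>2) \<longlonglongrightarrow> \<sigma>"
  shows "(\<lambda>N. real (card (pts (\<lambda>d c. Q d c \<and> coprime d c) a b N)) / (real N)\<^sup>2)
    \<longlonglongrightarrow> (b - a) * (\<sigma> / (2 * odd_zeta))"
proof -
  define A where "A N = real (card (pts Q a b N))" for N
  define L where "L N = real (card (pts (\<lambda>d c. Q d c \<and> coprime d c) a b N))" for N
  define S where "S N = (\<Sum>c | c \<in> {1..int N} \<and> R c. real_of_int c)" for N
  define \<kappa> where "\<kappa> = (b - a) * (\<sigma> / (2 * odd_zeta))"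
  have A: "\<bar>A N - (b - a) / 2 * S N\<bar> \<le> real N" for N
    unfolding A_def S_def using card_pts_approx[OF assms(1,2)] .
  have Alim: "(\<lambda>N. A N / (real N)\<^sup>2) \<longlonglongrightarrow> (b - a) / 2 * \<sigma>"
  proof -
    have "(\<lambda>N. (A N - (b - a) / 2 * S N) / (real N)\<^sup>2) \<longlonglongrightarrow> 0"
    proof (rule Lim_null_comparison)
      show "\<forall>\<^sub>F N in sequentially. norm ((A N - (b - a) / 2 * S N) / (real N)\<^sup>2) \<le> inverse (real N)"
        using eventually_gt_at_top[of 0]
      proof eventually_elim
        case (elim N)
        then show ?case using A[of N] by (simp add: field_simps power2_eq_square)
      qed
    qed (rule lim_inverse_n)
    from tendsto_add[OF this tendsto_mult_left[OF assms(4), of "(b - a) / 2"]]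
    show ?thesis by (simp add: S_def diff_divide_distrib)
  qed
  have S: "S N \<le> (real N)\<^sup>2" "S N \<ge> 0" for N
  proof -
    have "S N \<le> (\<Sum>c = 1..int N. real_of_int c)" unfolding S_def by (intro sum_mono2) auto
    also have "\<dots> \<le> (\<Sum>c = 1..int N. real N)" by (intro sum_mono) auto
    finally show "S N \<le> (real N)\<^sup>2" by (simp add: power2_eq_square)
    show "S N \<ge> 0" unfolding S_def by (intro sum_nonneg) auto
  qed
  have AL: "A N = (\<Sum>e | e \<in> {1..N} \<and> odd e. L (N div e))" for N
    using card_pts_gcd[of Q a b N, OF assms(3)] unfolding A_def L_def by (simp only: of_nat_sum)
  have Lbound: "\<bar>L N - \<kappa> * (real N)\<^sup>2\<bar> \<le> ((b - a) / 2 + 1 + \<bar>\<kappa>\<bar>) * (real N)\<^sup>2" for N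
  proof -
    have "L N \<le> A N" unfolding L_def A_def by (simp, rule card_mono[OF finite_pts]) (auto simp: pts_def)
    moreover have "A N \<le> (b - a) / 2 * (real N)\<^sup>2 + (real N)\<^sup>2"
    proof -
      have "(b - a) / 2 * S N \<le> (b - a) / 2 * (real N)\<^sup>2" using assms(1) S by (intro mult_left_mono) auto
      moreover have "real N \<le> (real N)\<^sup>2" by (cases "N = 0") (auto simp: power2_eq_square)
      ultimately show ?thesis using A[of N] by linarith
    qed
    moreover have "L N \<ge> 0" by (simp add: L_def)
    moreover have "\<bar>\<kappa> * (real N)\<^sup>2\<bar> = \<bar>\<kappa>\<bar> * (real N)\<^sup>2" by (simp add: abs_mult)
    ultimately show ?thesis unfolding distrib_right by linarith
  qed
  have "(\<lambda>N. (\<Sum>e | e \<in> {1..N} \<and> odd e. L (N div e) - \<kappa> * (real (N div e))\<^sup>2) / (real N)\<^sup>2) \<longlonglongrightarrow> 0"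
  proof -
    have "(\<lambda>N. A N / (real N)\<^sup>2 - \<kappa> * ((\<Sum>e | e \<in> {1..N} \<and> odd e. (real (N div e))\<^sup>2) / (real N)\<^sup>2))
        \<longlonglongrightarrow> (b - a) / 2 * \<sigma> - \<kappa> * odd_zeta"
      by (intro tendsto_diff tendsto_mult tendsto_const Alim sum_odd_div_squares)
    moreover have "(b - a) / 2 * \<sigma> - \<kappa> * odd_zeta = 0"
      using odd_zeta_pos by (simp add: \<kappa>_def)
    ultimately show ?thesis
      by (simp add: AL sum_subtractf sum_distrib_left diff_divide_distrib)
  qed
  from odd_deconvolution[OF Lbound this]
  have "(\<lambda>N. (L N - \<kappa> * (real N)\<^sup>2) / (real N)\<^sup>2) \<longlonglongrightarrow> 0" .
  from tendsto_add[OF this tendsto_const[of \<kappa>]]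
  have "(\<lambda>N. (L N - \<kappa> * (real N)\<^sup>2) / (real N)\<^sup>2 + \<kappa>) \<longlonglongrightarrow> \<kappa>" by simp
  moreover have "\<forall>\<^sub>F N in sequentially. (L N - \<kappa> * (real N)\<^sup>2) / (real N)\<^sup>2 + \<kappa> = L N / (real N)\<^sup>2"
    using eventually_gt_at_top[of 0] by eventually_elim (simp add: field_simps)
  ultimately show ?thesis
    unfolding L_def[symmetric] \<kappa>_def[symmetric] by (rule Lim_transform_eventually)
qed

lemma sum_int_eq:
  "(\<Sum>c = 1..int N. real_of_int c) = real N * (real N + 1) / 2"
proof (induction N)
  case (Suc N)
  have "{1..int (Suc N)} = insert (int (Suc N)) {1..int N}" by auto
  then show ?case using Suc by (simp add: field_simps)
qed simp

lemma sum_odd_int_eq: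
  "(\<Sum>c | c \<in> {1..int N} \<and> odd c. real_of_int c) = (real ((N + 1) div 2))\<^sup>2"
proof (induction N)
  case (Suc N)
  have fin: "finite {c. c \<in> {1..int N} \<and> odd c}" by (rule finite_subset[of _ "{1..int N}"]) auto
  show ?case
  proof (cases "even N")
    case True
    then obtain k where k: "N = 2 * k" by (elim evenE)
    have "{c. c \<in> {1..int (Suc N)} \<and> odd c} = insert (int (Suc N)) {c. c \<in> {1..int N} \<and> odd c}"
      using True by auto
    then show ?thesis using Suc fin k by (simp add: power2_eq_square algebra_simps)
  next
    case False
    then obtain k where k: "N = 2 * k + 1" by (elim oddE)
    have "c \<noteq> int (Suc N)" if "odd c" for c using that False by auto
    then have "{c. c \<in> {1..int (Suc N)} \<and> odd c} = {c. c \<in> {1..int N} \<and> odd c}"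
      by force
    then show ?thesis using Suc k by simp
  qed
qed simp

lemma card_odd_coprime_pts_limit:
  assumes "a \<le> b"
  shows "(\<lambda>N. real (card (pts (\<lambda>d c. odd d \<and> coprime d c) a b N)) / (real N)\<^sup>2)
    \<longlonglongrightarrow> (b - a) * (1 / (4 * odd_zeta))"
proof -
  have "(\<lambda>N. (\<Sum>c | c \<in> {1..int N} \<and> True. real_of_int c) / (real N)\<^sup>2) \<longlonglongrightarrow> 1 / 2"
  proof -
    have "(\<lambda>N. 1 / 2 + inverse (real N) / 2) \<longlonglongrightarrow> 1 / 2 + 0 / 2"
      by (intro tendsto_add tendsto_const tendsto_divide lim_inverse_n) simp
    moreover have "\<forall>\<^sub>F N in sequentially. 1 / 2 + inverse (real N) / 2 =
        (\<Sum>c | c \<in> {1..int N} \<and> True. real_of_int c) / (real N)\<^sup>2"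
      using eventually_gt_at_top[of 0]
    proof eventually_elim
      case (elim N)
      have "(\<Sum>c | c \<in> {1..int N} \<and> True. real_of_int c) = real N * (real N + 1) / 2"
        using sum_int_eq[of N] by (simp only: simp_thms Collect_mem_eq)
      then show ?case using elim by (simp add: field_simps power2_eq_square)
    qed
    ultimately show ?thesis using Lim_transform_eventually by fastforce
  qed
  then have "(\<lambda>N. real (card (pts (\<lambda>d c. odd d \<and> coprime d c) a b N)) / (real N)\<^sup>2)
    \<longlonglongrightarrow> (b - a) * (1 / 2 / (2 * odd_zeta))"
    by (intro card_coprime_pts_limit[where r = 1 and R = "\<lambda>_. True", OF assms])
      (auto simp: odd_iff_mod_2_eq_one[symmetric])
  then show ?thesis by simp
qed

text \<open>Counts the fractions at which strips are attached.\<close>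

lemma card_even_odd_coprime_pts_limit:
  assumes "a \<le> b"
  shows "(\<lambda>N. real (card (pts (\<lambda>d c. (even d \<and> odd c) \<and> coprime d c) a b N)) / (real N)\<^sup>2)
    \<longlonglongrightarrow> (b - a) * (1 / (8 * odd_zeta))"
proof -
  have "(\<lambda>N. (\<Sum>c | c \<in> {1..int N} \<and> odd c. real_of_int c) / (real N)\<^sup>2) \<longlonglongrightarrow> 1 / 4"
  proof -
    have "(\<lambda>N. real ((N + 1) div 2) / real N) \<longlonglongrightarrow> 1 / 2"
    proof (rule tendsto_sandwich)
      show "\<forall>\<^sub>F N in sequentially. 1 / 2 \<le> real ((N + 1) div 2) / real N"
        using eventually_gt_at_top[of 0]
      proof eventually_elim
        case (elim N)
        have "N \<le> 2 * ((N + 1) div 2)" by linarith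
        then have "real N \<le> 2 * real ((N + 1) div 2)" by linarith
        then show ?case using elim by (simp add: field_simps)
      qed
      show "\<forall>\<^sub>F N in sequentially. real ((N + 1) div 2) / real N \<le> 1 / 2 + inverse (real N) / 2"
        using eventually_gt_at_top[of 0]
      proof eventually_elim
        case (elim N)
        have "2 * ((N + 1) div 2) \<le> N + 1" by linarith
        then have "2 * real ((N + 1) div 2) \<le> real N + 1" by linarith
        then show ?case using elim by (simp add: field_simps)
      qed
      have "(\<lambda>N. 1 / 2 + inverse (real N) / 2) \<longlonglongrightarrow> 1 / 2 + 0 / 2"
        by (intro tendsto_add tendsto_const tendsto_divide lim_inverse_n) simp
      then show "(\<lambda>N. 1 / 2 + inverse (real N) / 2) \<longlonglongrightarrow> 1 / 2" by simp
    qed simp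
    from tendsto_power[OF this, of 2] show ?thesis
      unfolding sum_odd_int_eq by (simp add: power_divide)
  qed
  then have "(\<lambda>N. real (card (pts (\<lambda>d c. (even d \<and> odd c) \<and> coprime d c) a b N)) / (real N)\<^sup>2)
    \<longlonglongrightarrow> (b - a) * (1 / 4 / (2 * odd_zeta))"
    by (intro card_coprime_pts_limit[where r = 0 and R = odd, OF assms])
      (auto simp: even_iff_mod_2_eq_zero[symmetric])
  then show ?thesis by simp
qed

subsection \<open>Filling intervals with strips\<close>

lemma pts_empty: "pts Q a a N = {}"
  by (auto simp: pts_def)

text \<open>
  Distinct fractions with denominators in \<open>(M, 2M]\<close> are at least \<open>1 / (4M\<^sup>2)\<close> apart, and there are
  enough of them to fill a fixed proportion of any interval as soon as \<open>M\<close> is large.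
\<close>

lemma strips_fill:
  fixes e :: real
  assumes "0 < e" "e \<le> 1 / 4"
  obtains c where "0 < c" "c < 1"
    "\<And>a b. 0 \<le> a \<Longrightarrow> a < b \<Longrightarrow> \<exists>F :: (int \<times> int) set. finite F \<and>
      (\<forall>(p, q)\<in>F. 0 \<le> p \<and> 0 < q \<and> even p \<and> coprime p q \<and> a \<le> p / q \<and> p / q + e / (real_of_int q)\<^sup>2 \<le> b) \<and>
      (\<forall>(p, q)\<in>F. \<forall>(p', q')\<in>F. (p, q) \<noteq> (p', q') \<longrightarrow>
         p / q + e / (real_of_int q)\<^sup>2 \<le> p' / q' \<or> p' / q' + e / (real_of_int q')\<^sup>2 \<le> p / q) \<and>
      c * (b - a) \<le> (\<Sum>(p, q)\<in>F. e / (real_of_int q)\<^sup>2)"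
proof -
  define l where "l = 1 / (8 * odd_zeta)"
  have l: "l > 0" using odd_zeta_pos by (simp add: l_def)
  \<comment> \<open>At least 2 (x - a) l M^2 strips, each of length at least e / (4 M^2), with x - a
    = (b - a) / 2, have total length at least e l / 4 times b - a. The minimum with 1/2 only keeps c
    below 1.\<close>
  define c where "c = min (1 / 2) (e * l / 4)"
  show ?thesis
  proof (rule that[of c])
    show "0 < c" "c < 1" using l assms by (auto simp: c_def)
    fix a b :: real assume ab: "0 \<le> a" "a < b"
    \<comment> \<open>The fractions are taken from the left half of the interval, so that strips,
      which extend to the right, still end before b.\<close>
    define x where "x = (a + b) / 2"
    define P where "P = pts (\<lambda>d c. (even d \<and> odd c) \<and> coprime d c) a x"
    define L where "L N = real (card (P N))" for N
    have x: "a < x" "x < b" "x - a = (b - a) / 2" using ab by (auto simp: x_def field_simps)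
    have lim: "(\<lambda>N. L N / (real N)\<^sup>2) \<longlonglongrightarrow> (x - a) * l"
      unfolding L_def P_def l_def by (rule card_even_odd_coprime_pts_limit) (use x in simp)
    have lpos: "(x - a) * l > 0" using x l by simp
    have "\<forall>\<^sub>F N in sequentially. 9 / 10 * ((x - a) * l) < L N / (real N)\<^sup>2"
      "\<forall>\<^sub>F N in sequentially. L N / (real N)\<^sup>2 < 11 / 10 * ((x - a) * l)"
      by (rule order_tendstoD[OF lim], use lpos in linarith)+
    then have "\<forall>\<^sub>F N in sequentially. 9 / 10 * ((x - a) * l) < L N / (real N)\<^sup>2 \<and>
        L N / (real N)\<^sup>2 < 11 / 10 * ((x - a) * l)" by (rule eventually_conj)
    then obtain M0 where M0: "9 / 10 * ((x - a) * l) < L N / (real N)\<^sup>2 \<and>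
        L N / (real N)\<^sup>2 < 11 / 10 * ((x - a) * l)" if "N \<ge> M0" for N
      unfolding eventually_sequentially by blast
    obtain M1 :: nat where M1: "e / (b - x) < real M1" using reals_Archimedean2 by blast
    define M where "M = Suc (max M0 M1)"
    have M: "M \<ge> M0" "M \<ge> M1" "M \<ge> 1" by (auto simp: M_def)
    have Mpos: "real M > 0" using M by simp
    have eM: "e / (real M)\<^sup>2 \<le> b - x"
    proof -
      have "e / (b - x) < real M" using M1 M by linarith
      also have "\<dots> \<le> (real M)\<^sup>2" using M by (simp add: power2_eq_square)
      finally show ?thesis using x Mpos by (simp add: field_simps)
    qed
    define F where "F = P (2 * M) - P M"
    have F: "0 \<le> p \<and> int M < q \<and> q \<le> 2 * int M \<and> even p \<and> coprime p q \<and> a \<le> p / q \<and> p / q < x"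
      if "(p, q) \<in> F" for p q
    proof -
      have 1: "1 \<le> q" "q \<le> 2 * int M" "even p" "coprime p q" "a * q \<le> p" "p < x * q" "int M < q"
        using that by (auto simp: F_def P_def pts_def)
      moreover have "0 \<le> a * q" using ab 1 by simp
      moreover have "a \<le> p / q" "p / q < x" using 1 by (simp_all add: field_simps)
      ultimately show ?thesis by auto
    qed
    have eq: "e / (real_of_int q)\<^sup>2 \<le> e / (real M)\<^sup>2" "e / (4 * (real M)\<^sup>2) \<le> e / (real_of_int q)\<^sup>2"
      if "(p, q) \<in> F" for p q
    proof -
      have "real M \<le> q" "q \<le> 2 * real M" using F[OF that] by linarith+
      then have "(real M)\<^sup>2 \<le> (real_of_int q)\<^sup>2" "(real_of_int q)\<^sup>2 \<le> (2 * real M)\<^sup>2"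
        using Mpos by (intro power_mono; linarith)+
      then show "e / (real_of_int q)\<^sup>2 \<le> e / (real M)\<^sup>2" "e / (4 * (real M)\<^sup>2) \<le> e / (real_of_int q)\<^sup>2"
        using assms Mpos F[OF that] by (auto intro!: divide_left_mono simp: power_mult_distrib)
    qed
    have sep: "p / q + e / (real_of_int q)\<^sup>2 \<le> p' / q'" if "(p, q) \<in> F" "(p', q') \<in> F" "p / q < p' / q'" for p q p' q' :: int
    proof -
      have q: "real M \<le> q" "q \<le> 2 * real M" "real M \<le> q'" "q' \<le> 2 * real M" "real_of_int q > 0" "real_of_int q' > 0"
        using F[OF that(1)] F[OF that(2)] by linarith+
      have "real_of_int (p * q') < real_of_int (p' * q)" using that(3) q by (simp add: field_simps)
      then have "p' * q - p * q' \<ge> 1" unfolding of_int_less_iff by linarith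
      then have "real_of_int (p' * q - p * q') \<ge> 1" by (simp only: of_int_1_le_iff)
      then have "1 / (q * q') \<le> real_of_int (p' * q - p * q') / (q * q')" using q by (intro divide_right_mono) auto
      also have "\<dots> = p' / q' - p / q" using q by (simp add: field_simps)
      finally have 1: "1 / (real_of_int q * q') \<le> p' / q' - p / q" by simp
      have "e / (real_of_int q)\<^sup>2 \<le> e / (real M)\<^sup>2" by (rule eq(1)[OF that(1)])
      \<comment> \<open>The bound e \<le> 1/4 makes a strip no longer than the minimal gap between
        the fractions.\<close>
      also have "\<dots> \<le> 1 / (4 * (real M)\<^sup>2)" using assms Mpos by (simp add: field_simps)
      also have "\<dots> \<le> 1 / (real_of_int q * q')"
      proof (rule divide_left_mono)
        have "real_of_int q * q' \<le> (2 * real M) * (2 * real M)" using q by (intro mult_mono) auto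
        then show "real_of_int q * q' \<le> 4 * (real M)\<^sup>2" by (simp add: power2_eq_square)
      qed (use q Mpos in auto)
      finally show ?thesis using 1 by simp
    qed
    have "finite F" unfolding F_def P_def using finite_pts by auto
    moreover have "\<forall>(p, q)\<in>F. 0 \<le> p \<and> 0 < q \<and> even p \<and> coprime p q \<and> a \<le> p / q \<and> p / q + e / (real_of_int q)\<^sup>2 \<le> b"
    proof -
      have "0 \<le> p \<and> 0 < q \<and> even p \<and> coprime p q \<and> a \<le> p / q \<and> p / q + e / (real_of_int q)\<^sup>2 \<le> b"
        if pq: "(p, q) \<in> F" for p q
        using F[OF pq] eq(1)[OF pq] eM by simp
      then show ?thesis by blast
    qed
    moreover have "\<forall>(p, q)\<in>F. \<forall>(p', q')\<in>F. (p, q) \<noteq> (p', q') \<longrightarrow>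
         p / q + e / (real_of_int q)\<^sup>2 \<le> p' / q' \<or> p' / q' + e / (real_of_int q')\<^sup>2 \<le> p / q"
    proof -
      have "p / q + e / (real_of_int q)\<^sup>2 \<le> p' / q' \<or> p' / q' + e / (real_of_int q')\<^sup>2 \<le> p / q"
        if pq: "(p, q) \<in> F" "(p', q') \<in> F" "(p, q) \<noteq> (p', q')" for p q p' q'
      proof -
      have "p / q \<noteq> p' / q'"
      proof
        assume "p / q = p' / q'"
        then have "real_of_int (p * q') = real_of_int (p' * q)"
          using F[OF pq(1)] F[OF pq(2)] by (simp add: field_simps)
        then have "p * q' = p' * q" by (simp only: of_int_eq_iff)
        moreover have "q > 0" "q' > 0" "coprime p q" "coprime p' q'" using F[OF pq(1)] F[OF pq(2)] by auto
        ultimately have "q dvd q'" "q' dvd q"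
          by (metis coprime_commute coprime_dvd_mult_right_iff dvd_triv_right)+
        then have "q = q'" using \<open>q > 0\<close> \<open>q' > 0\<close> by (simp add: zdvd_antisym_nonneg)
        then show False using \<open>p * q' = p' * q\<close> \<open>q > 0\<close> pq(3) by simp
      qed
      then show ?thesis using sep[OF pq(1,2)] sep[OF pq(2,1)] by linarith
      qed
      then show ?thesis by blast
    qed
    moreover have "c * (b - a) \<le> (\<Sum>(p, q)\<in>F. e / (real_of_int q)\<^sup>2)"
    proof -
      have "P M \<subseteq> P (2 * M)" by (auto simp: P_def pts_def)
      then have "real (card F) = L (2 * M) - L M"
        unfolding F_def L_def using finite_pts[of _ a x] P_def
        by (subst card_Diff_subset) (auto simp: of_nat_diff card_mono)
      moreover have "9 / 10 * ((x - a) * l) * (real (2 * M))\<^sup>2 < L (2 * M)"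
      proof -
        have "9 / 10 * ((x - a) * l) < L (2 * M) / (real (2 * M))\<^sup>2" using M0[of "2 * M"] M by simp
        then show ?thesis using Mpos by (subst (asm) pos_less_divide_eq) auto
      qed
      then have "9 / 10 * ((x - a) * l) * (4 * (real M)\<^sup>2) < L (2 * M)"
        by (simp add: power_mult_distrib)
      moreover have "L M < 11 / 10 * ((x - a) * l) * (real M)\<^sup>2"
      proof -
        have "L M / (real M)\<^sup>2 < 11 / 10 * ((x - a) * l)" using M0[of M] M by simp
        then show ?thesis using Mpos by (subst (asm) pos_divide_less_eq) auto
      qed
      moreover have "0 < (x - a) * l * (real M)\<^sup>2" using lpos Mpos by simp
      \<comment> \<open>The tolerances 9/10 and 11/10 leave 4 * 9/10 - 11/10 = 5/2, which exceeds
        2.\<close>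
      ultimately have card: "real (card F) \<ge> 2 * ((x - a) * l * (real M)\<^sup>2)" by argo
      have "c * (b - a) \<le> e * l / 4 * (b - a)"
        using ab by (intro mult_right_mono) (auto simp: c_def)
      also have "\<dots> = 2 * ((x - a) * l * (real M)\<^sup>2) * (e / (4 * (real M)\<^sup>2))"
        using Mpos unfolding x(3) by simp
      also have "\<dots> \<le> real (card F) * (e / (4 * (real M)\<^sup>2))"
        using card assms by (intro mult_right_mono) auto
      also have "\<dots> = (\<Sum>(p, q)\<in>F. e / (4 * (real M)\<^sup>2))" by (simp add: case_prod_unfold)
      also have "\<dots> \<le> (\<Sum>(p, q)\<in>F. e / (real_of_int q)\<^sup>2)"
        using eq(2) by (intro sum_mono) (auto simp del: of_int_power)
      finally show ?thesis .
    qed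
    ultimately show "\<exists>F :: (int \<times> int) set. finite F \<and>
      (\<forall>(p, q)\<in>F. 0 \<le> p \<and> 0 < q \<and> even p \<and> coprime p q \<and> a \<le> p / q \<and> p / q + e / (real_of_int q)\<^sup>2 \<le> b) \<and>
      (\<forall>(p, q)\<in>F. \<forall>(p', q')\<in>F. (p, q) \<noteq> (p', q') \<longrightarrow>
         p / q + e / (real_of_int q)\<^sup>2 \<le> p' / q' \<or> p' / q' + e / (real_of_int q')\<^sup>2 \<le> p / q) \<and>
      c * (b - a) \<le> (\<Sum>(p, q)\<in>F. e / (real_of_int q)\<^sup>2)"
      by blast
  qed
qed

section \<open>Contraction of the imbalance\<close>

context balanced_weight
begin

text \<open>The upper limit of |wsum a b N| / N^2 is at most K (b - a) on every interval. The
  threshold for N may depend on the interval; finitely many gaps are treated at a time.\<close>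

definition density_bound :: "real \<Rightarrow> bool" where
  "density_bound K \<longleftrightarrow> (\<forall>a b \<delta>. 0 \<le> a \<longrightarrow> a \<le> b \<longrightarrow> 0 < \<delta> \<longrightarrow>
    (\<forall>\<^sub>F N in sequentially. \<bar>wsum a b N\<bar> \<le> (K * (b - a) + \<delta>) * (real N)\<^sup>2))"

lemma density_boundD:
  assumes "density_bound K" "0 \<le> a" "a \<le> b" "0 < \<delta>"
  shows "\<forall>\<^sub>F N in sequentially. \<bar>wsum a b N\<bar> \<le> (K * (b - a) + \<delta>) * (real N)\<^sup>2"
  using assms unfolding density_bound_def by blast

lemma density_bound_mono:
  assumes "density_bound K" "K \<le> L"
  shows "density_bound L"
  unfolding density_bound_def
proof (intro allI impI)
  fix a b \<delta> :: real assume *: "0 \<le> a" "a \<le> b" "0 < \<delta>"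
  have "K * (b - a) \<le> L * (b - a)" using assms(2) * by (intro mult_right_mono) auto
  then have "(K * (b - a) + \<delta>) * (real N)\<^sup>2 \<le> (L * (b - a) + \<delta>) * (real N)\<^sup>2" for N
    by (intro mult_right_mono) auto
  then show "\<forall>\<^sub>F N in sequentially. \<bar>wsum a b N\<bar> \<le> (L * (b - a) + \<delta>) * (real N)\<^sup>2"
    using density_boundD[OF assms(1) *] by (elim eventually_mono) (rule order_trans)
qed

text \<open>Starts the iteration: as weights have size at most 1, the density of all points serves
  as the constant.\<close>

lemma density_bound_trivial: "density_bound (1 / (4 * odd_zeta))"
  unfolding density_bound_def
proof (intro allI impI)
  fix a b \<delta> :: real assume *: "0 \<le> a" "a \<le> b" "0 < \<delta>"
  have "\<forall>\<^sub>F N in sequentially. real (card (pts odd_coprime a b N)) / (real N)\<^sup>2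
      < (b - a) * (1 / (4 * odd_zeta)) + \<delta>"
    using order_tendstoD(2)[OF card_odd_coprime_pts_limit[OF *(2)]] *(3) by simp
  then show "\<forall>\<^sub>F N in sequentially. \<bar>wsum a b N\<bar> \<le> (1 / (4 * odd_zeta) * (b - a) + \<delta>) * (real N)\<^sup>2"
    using eventually_gt_at_top[of 0]
  proof eventually_elim
    case (elim N)
    have "\<bar>wsum a b N\<bar> \<le> (\<Sum>z\<in>pts odd_coprime a b N. 1)"
      unfolding wsum_def using bounded by (intro order_trans[OF sum_abs] sum_mono) auto
    also have "\<dots> \<le> (1 / (4 * odd_zeta) * (b - a) + \<delta>) * (real N)\<^sup>2"
      using elim by (simp add: pos_divide_less_eq mult.commute)
    finally show ?case .
  qed
qed

lemma wsum_split:
  assumes "a \<le> x" "x \<le> b"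
  shows "wsum a b N = wsum a x N + wsum x b N"
  unfolding wsum_def by (rule sum_pts_split[OF assms])

text \<open>Strips are charged at rate \<kappa> and gaps at rate K. The induction removes the
  rightmost strip: the others lie to its left, and the gap to its right is a single interval. Hence
  b varies, and half of \<delta> is spent on that gap.\<close>

lemma density_bound_fill:
  fixes u v :: "'i \<Rightarrow> real"
  assumes K: "density_bound K" and "finite F"
    and "\<And>i. i \<in> F \<Longrightarrow> a \<le> u i \<and> u i < v i \<and> v i \<le> b"
    and "\<And>i j. i \<in> F \<Longrightarrow> j \<in> F \<Longrightarrow> i \<noteq> j \<Longrightarrow> v i \<le> u j \<or> v j \<le> u i"
    and bd: "\<And>i N. i \<in> F \<Longrightarrow> \<bar>wsum (u i) (v i) N\<bar> \<le> \<kappa> * (v i - u i) * (real N)\<^sup>2"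
    and "0 \<le> a" "a \<le> b" "0 < \<delta>"
  shows "\<forall>\<^sub>F N in sequentially.
    \<bar>wsum a b N\<bar> \<le> (K * (b - a) - (K - \<kappa>) * (\<Sum>i\<in>F. v i - u i) + \<delta>) * (real N)\<^sup>2"
  using assms(2-)
proof (induction F arbitrary: b \<delta> rule: finite_ranking_induct[where f = u])
  case empty
  then show ?case using density_boundD[OF K] by simp
next
  case (insert i S)
  show ?case
  proof (cases "i \<in> S")
    case True
    then have eq: "insert i S = S" by auto
    note prems = insert.prems[unfolded eq]
    show ?thesis unfolding eq by (rule insert.IH) (fact prems)+
  next
    case False
    have i: "a \<le> u i" "u i < v i" "v i \<le> b" using insert.prems(1)[of i] by auto
    have S: "v j \<le> u i" if "j \<in> S" for j
    proof -
      have "v j \<le> u i \<or> v i \<le> u j" using insert.prems(2)[of i j] False that by auto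
      moreover have "u j \<le> u i" using insert.hyps that by auto
      ultimately show ?thesis using i by linarith
    qed
    have "\<forall>\<^sub>F N in sequentially. \<bar>wsum a (u i) N\<bar>
        \<le> (K * (u i - a) - (K - \<kappa>) * (\<Sum>i\<in>S. v i - u i) + \<delta> / 2) * (real N)\<^sup>2"
    proof (rule insert.IH)
      show "a \<le> u j \<and> u j < v j \<and> v j \<le> u i" if "j \<in> S" for j
        using that S[OF that] insert.prems(1)[of j] by auto
    qed (use insert.prems(2-6) i in auto)
    moreover have "\<forall>\<^sub>F N in sequentially. \<bar>wsum (v i) b N\<bar> \<le> (K * (b - v i) + \<delta> / 2) * (real N)\<^sup>2"
      by (rule density_boundD[OF K]) (use i insert.prems(4-6) in linarith)+
    ultimately show ?thesis
    proof eventually_elim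
      case (elim N)
      have "wsum a b N = wsum a (u i) N + wsum (u i) (v i) N + wsum (v i) b N"
        using wsum_split[of a "u i" b N] wsum_split[of "u i" "v i" b N] i by simp
      then have "\<bar>wsum a b N\<bar> \<le> \<bar>wsum a (u i) N\<bar> + \<bar>wsum (u i) (v i) N\<bar> + \<bar>wsum (v i) b N\<bar>" by linarith
      also have "\<dots> \<le> (K * (u i - a) - (K - \<kappa>) * (\<Sum>i\<in>S. v i - u i) + \<delta> / 2) * (real N)\<^sup>2
          + \<kappa> * (v i - u i) * (real N)\<^sup>2 + (K * (b - v i) + \<delta> / 2) * (real N)\<^sup>2"
        using elim insert.prems(3)[of i N] by (intro add_mono) auto
      also have "\<dots> = (K * (b - a) - (K - \<kappa>) * (\<Sum>i\<in>insert i S. v i - u i) + \<delta>) * (real N)\<^sup>2"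
        using False insert.hyps by (simp add: algebra_simps)
      finally show ?case .
    qed
  qed
qed

text \<open>Filling the proportion c of each interval with strips of rate m e turns K into (1 - c) K
  + c m e. The fixed point is m e, and the additional e is the tolerance of
  \<open>contraction_limit\<close>.\<close>

lemma density_bound_small:
  fixes e :: real
  assumes "0 < e" "e \<le> 1 / 4"
  shows "density_bound (real m * e + e)"
proof -
  obtain c where c: "0 < c" "c < 1"
    "\<And>a b. 0 \<le> a \<Longrightarrow> a < b \<Longrightarrow> \<exists>F :: (int \<times> int) set. finite F \<and>
      (\<forall>(p, q)\<in>F. 0 \<le> p \<and> 0 < q \<and> even p \<and> coprime p q \<and> a \<le> p / q \<and> p / q + e / (real_of_int q)\<^sup>2 \<le> b) \<and>
      (\<forall>(p, q)\<in>F. \<forall>(p', q')\<in>F. (p, q) \<noteq> (p', q') \<longrightarrow>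
         p / q + e / (real_of_int q)\<^sup>2 \<le> p' / q' \<or> p' / q' + e / (real_of_int q')\<^sup>2 \<le> p / q) \<and>
      c * (b - a) \<le> (\<Sum>(p, q)\<in>F. e / (real_of_int q)\<^sup>2)"
    using strips_fill[OF assms] by blast
  have "density_bound ((1 - c) * K + c * (real m * e))" if K: "density_bound K" for K
  proof (cases "K \<ge> real m * e")
    case False
    \<comment> \<open>If K is already below m e, the new constant is larger than K and monotonicity
      suffices.\<close>
    then have "0 \<le> c * (real m * e - K)" using c by simp
    then show ?thesis by (intro density_bound_mono[OF K]) (simp add: algebra_simps)
  next
    case True
    show ?thesis
      unfolding density_bound_def
    proof (intro allI impI)
      fix a b \<delta> :: real assume *: "0 \<le> a" "a \<le> b" "0 < \<delta>"
      show "\<forall>\<^sub>F N in sequentially.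
          \<bar>wsum a b N\<bar> \<le> (((1 - c) * K + c * (real m * e)) * (b - a) + \<delta>) * (real N)\<^sup>2"
      proof (cases "a = b")
        case True
        then show ?thesis using * by (simp add: wsum_def pts_empty)
      next
        case False
        then have "a < b" using * by simp
        obtain F :: "(int \<times> int) set" where F: "finite F"
          "\<forall>(p, q)\<in>F. 0 \<le> p \<and> 0 < q \<and> even p \<and> coprime p q \<and> a \<le> p / q \<and> p / q + e / (real_of_int q)\<^sup>2 \<le> b"
          "\<forall>(p, q)\<in>F. \<forall>(p', q')\<in>F. (p, q) \<noteq> (p', q') \<longrightarrow>
             p / q + e / (real_of_int q)\<^sup>2 \<le> p' / q' \<or> p' / q' + e / (real_of_int q')\<^sup>2 \<le> p / q"
          "c * (b - a) \<le> (\<Sum>(p, q)\<in>F. e / (real_of_int q)\<^sup>2)"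
          using c(3)[OF *(1) \<open>a < b\<close>] by (elim exE conjE) (rule that)
        define u where "u = (\<lambda>(p, q). real_of_int p / real_of_int q)"
        define v where "v = (\<lambda>(p, q). real_of_int p / real_of_int q + e / (real_of_int q)\<^sup>2)"
        have "\<forall>\<^sub>F N in sequentially. \<bar>wsum a b N\<bar>
            \<le> (K * (b - a) - (K - real m * e) * (\<Sum>i\<in>F. v i - u i) + \<delta>) * (real N)\<^sup>2"
        proof (rule density_bound_fill[OF K F(1)])
          fix i assume i: "i \<in> F"
          obtain p q where pq: "i = (p, q)" by (cases i)
          have 1: "0 \<le> p" "0 < q" "even p" "coprime p q" "a \<le> p / q" "p / q + e / (real_of_int q)\<^sup>2 \<le> b"
            using F(2) i pq by auto
          then show "a \<le> u i \<and> u i < v i \<and> v i \<le> b"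
            using assms by (simp add: u_def v_def pq)
          fix N
          have "\<bar>wsum (u i) (v i) N\<bar> \<le> real m * (e * real N / q)\<^sup>2"
            using strip_bound[OF 1(1-4) assms(1)] assms(2) by (simp add: u_def v_def pq)
          also have "\<dots> = real m * e * (v i - u i) * (real N)\<^sup>2"
            by (simp add: u_def v_def pq power2_eq_square)
          finally show "\<bar>wsum (u i) (v i) N\<bar> \<le> real m * e * (v i - u i) * (real N)\<^sup>2" .
        next
          fix i j assume "i \<in> F" "j \<in> F" "i \<noteq> j"
          then show "v i \<le> u j \<or> v j \<le> u i"
            using F(3) by (cases i; cases j) (fastforce simp: u_def v_def)
        qed (use * in auto)
        moreover have "K * (b - a) - (K - real m * e) * (\<Sum>i\<in>F. v i - u i) + \<delta>
            \<le> ((1 - c) * K + c * (real m * e)) * (b - a) + \<delta>"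
        proof -
          have "(\<Sum>i\<in>F. v i - u i) = (\<Sum>(p, q)\<in>F. e / (real_of_int q)\<^sup>2)"
            by (intro sum.cong) (auto simp: u_def v_def)
          then have "(K - real m * e) * (c * (b - a)) \<le> (K - real m * e) * (\<Sum>i\<in>F. v i - u i)"
            using F(4) True by (intro mult_left_mono) auto
          then show ?thesis by (simp add: algebra_simps)
        qed
        ultimately show ?thesis
          by (elim eventually_mono) (meson mult_right_mono order_trans zero_le_power2)
      qed
    qed
  qed
  from contraction_limit[of density_bound, OF density_bound_trivial this density_bound_mono, where \<delta> = e]
  show ?thesis using c assms by simp
qed

lemma wsum_limit:
  assumes "0 \<le> a" "a \<le> b"
  shows "(\<lambda>N. wsum a b N / (real N)\<^sup>2) \<longlonglongrightarrow> 0"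
proof (rule tendstoI)
  fix \<epsilon> :: real assume \<epsilon>: "\<epsilon> > 0"
  \<comment> \<open>Chosen so that (m + 1) e (b - a) \<le> \<epsilon> / 4; the summand 1 in b - a +
    1 keeps the denominator positive when a = b.\<close>
  define e where "e = min (1 / 4) (\<epsilon> / (4 * (real m + 1) * (b - a + 1)))"
  have "e \<le> 1 / 4" unfolding e_def by (rule min.cobounded1)
  moreover have "0 < e" using \<epsilon> assms by (auto simp: e_def intro!: divide_pos_pos mult_pos_pos)
  ultimately have e: "0 < e" "e \<le> 1 / 4" by blast+
  have "(real m * e + e) * (b - a) \<le> \<epsilon> / 4"
  proof -
    have "(real m * e + e) * (b - a) = e * ((real m + 1) * (b - a))" by (simp add: algebra_simps)
    also have "\<dots> \<le> e * ((real m + 1) * (b - a + 1))"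
      using e by (intro mult_left_mono) auto
    also have "\<dots> \<le> \<epsilon> / (4 * (real m + 1) * (b - a + 1)) * ((real m + 1) * (b - a + 1))"
      using assms by (intro mult_right_mono) (auto simp: e_def)
    also have "\<dots> = \<epsilon> / 4" using assms by (simp add: divide_simps)
    finally show ?thesis .
  qed
  then have *: "(real m * e + e) * (b - a) + \<epsilon> / 4 \<le> \<epsilon> / 2" by simp
  have "\<forall>\<^sub>F N in sequentially. \<bar>wsum a b N\<bar> \<le> ((real m * e + e) * (b - a) + \<epsilon> / 4) * (real N)\<^sup>2"
    using \<epsilon> by (intro density_boundD[OF density_bound_small[OF e] assms]) auto
  then show "\<forall>\<^sub>F N in sequentially. dist (wsum a b N / (real N)\<^sup>2) 0 < \<epsilon>"
    using eventually_gt_at_top[of 0]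
  proof eventually_elim
    case (elim N)
    have "\<bar>wsum a b N\<bar> / (real N)\<^sup>2 \<le> (real m * e + e) * (b - a) + \<epsilon> / 4"
      using elim by (simp add: pos_divide_le_eq)
    moreover have "dist (wsum a b N / (real N)\<^sup>2) 0 = \<bar>wsum a b N\<bar> / (real N)\<^sup>2" by simp
    ultimately show ?case using * \<epsilon> by linarith
  qed
qed

end

subsection \<open>Equidistribution\<close>

text \<open>Exactly one of m consecutive integers lies in a given class, namely the one at offset (s
  - n) mod m.\<close>

lemma balanced_weight_residue:
  fixes m :: nat and s :: int
  assumes "m > 0" "0 \<le> s" "s < int m"
  shows "balanced_weight m (\<lambda>n. of_bool (n mod int m = s) - 1 / real m)"
proof
  show "m > 0" by fact
  fix n :: int
  define i where "i = nat ((s - n) mod int m)"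
  have i: "i < m" "int i = (s - n) mod int m" using assms(1) by (auto simp: i_def nat_less_iff)
  have "(n + int j) mod int m = s \<longleftrightarrow> j = i" if "j < m" for j
  proof -
    have "(n + int j) mod int m = s \<longleftrightarrow> int j mod int m = (s - n) mod int m"
      using assms by (metis add_diff_cancel_left' mod_diff_left_eq add.commute diff_add_cancel mod_add_left_eq mod_pos_pos_trivial)
    also have "\<dots> \<longleftrightarrow> j = i" using that unfolding i(2)[symmetric] by simp
    finally show ?thesis .
  qed
  then have "(\<Sum>j<m. of_bool ((n + int j) mod int m = s) :: real) = (\<Sum>j<m. of_bool (j = i))"
    by (intro sum.cong) auto
  also have "\<dots> = 1" using i by (simp add: of_bool_def)
  finally show "(\<Sum>j<m. of_bool ((n + int j) mod int m = s) - 1 / real m) = 0"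
    using assms(1) by (simp add: sum_subtractf)
  show "\<bar>of_bool (n mod int m = s) - 1 / real m\<bar> \<le> 1"
    using assms(1) by (cases "n mod int m = s") (auto simp: field_simps)
qed

text \<open>The points in one class number 1/m of all points plus the weighted sum, and the latter
  is o(N^2).\<close>

lemma hardy_S4_residue_limit:
  fixes m :: nat and s :: int
  assumes "m > 0" "0 \<le> s" "s < int m" "0 \<le> a" "a \<le> b"
  shows "(\<lambda>N. real (card {(d, c) \<in> pts (\<lambda>d c. odd d \<and> coprime d c) a b N. hardy_S4 d c mod int m = s}) / (real N)\<^sup>2)
    \<longlonglongrightarrow> (b - a) * (1 / (4 * odd_zeta)) / real m"
proof -
  interpret balanced_weight m "\<lambda>n. of_bool (n mod int m = s) - 1 / real m"
    by (rule balanced_weight_residue[OF assms(1-3)])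
  have "wsum a b N + real (card (pts odd_coprime a b N)) / m =
      real (card {(d, c) \<in> pts odd_coprime a b N. hardy_S4 d c mod int m = s})" for N
  proof -
    have "wsum a b N + real (card (pts odd_coprime a b N)) / m =
        (\<Sum>(d, c)\<in>pts odd_coprime a b N. of_bool (hardy_S4 d c mod int m = s))"
      unfolding wsum_def by (simp add: case_prod_unfold sum_subtractf)
    also have "\<dots> = real (card {(d, c) \<in> pts odd_coprime a b N. hardy_S4 d c mod int m = s})"
      using finite_pts by (simp add: case_prod_unfold of_bool_def sum.If_cases Int_def)
    finally show ?thesis .
  qed
  note eq = this[symmetric]
  have "(\<lambda>N. wsum a b N / (real N)\<^sup>2 + real (card (pts odd_coprime a b N)) / (real N)\<^sup>2 / m)
      \<longlonglongrightarrow> 0 + (b - a) * (1 / (4 * odd_zeta)) / m"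
    by (intro tendsto_add wsum_limit tendsto_divide card_odd_coprime_pts_limit tendsto_const assms(4,5))
      (use assms in auto)
  then show ?thesis unfolding eq by (simp add: add_divide_distrib mult.commute)
qed

section \<open>From intervals to continuous functions\<close>

lemma norm_integral_Riemann_sum:
  fixes g :: "real \<Rightarrow> complex" and k :: nat
  assumes "continuous_on {0..1} g" "k > 0"
    and "\<And>x y. x \<in> {0..1} \<Longrightarrow> y \<in> {0..1} \<Longrightarrow> \<bar>x - y\<bar> \<le> 1 / k \<Longrightarrow> norm (g x - g y) \<le> \<epsilon>"
  shows "norm (integral {0..1} g - (\<Sum>j<k. g (real j / real k)) / k) \<le> \<epsilon>"
proof -
  \<comment> \<open>Induction on the number of cells covered; each cell adds an error of at most
    \<epsilon> / k.\<close>
  have "norm (integral {0..real n / k} g - (\<Sum>j<n. g (real j / real k)) / k) \<le> real n / k * \<epsilon>" if "n \<le> k" for n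
    using that
  proof (induction n)
    case (Suc n)
    define u v where "u = real n / k" and "v = real (Suc n) / k"
    have uv: "0 \<le> u" "u \<le> v" "v \<le> 1" "v - u = 1 / k"
      using Suc.prems assms(2) by (auto simp: u_def v_def field_simps)
    have cont: "continuous_on {u..v} g" by (rule continuous_on_subset[OF assms(1)]) (use uv in auto)
    have "integral {0..v} g = integral {0..u} g + integral {u..v} g"
      using uv by (intro Henstock_Kurzweil_Integration.integral_combine[symmetric]
          integrable_continuous_real continuous_on_subset[OF assms(1)]) auto
    moreover have "integral {u..v} (\<lambda>x. g x - g u) = integral {u..v} g - g u / k"
    proof -
      have "integral {u..v} (\<lambda>x. g x - g u) = integral {u..v} g - integral {u..v} (\<lambda>x. g u)"
        by (intro integral_diff integrable_continuous_real cont continuous_on_const)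
      also have "integral {u..v} (\<lambda>x. g u) = g u / k" using uv by (simp add: scaleR_conv_of_real)
      finally show ?thesis .
    qed
    ultimately have eq: "integral {0..v} g - (\<Sum>j<Suc n. g (real j / real k)) / k =
        (integral {0..u} g - (\<Sum>j<n. g (real j / real k)) / k) + integral {u..v} (\<lambda>x. g x - g u)"
      by (simp add: u_def add_divide_distrib)
    have "norm (integral {u..v} (\<lambda>x. g x - g u)) \<le> \<epsilon> * (v - u)"
      using uv by (intro integral_bound continuous_intros cont assms(3)) auto
    then have "norm (integral {0..v} g - (\<Sum>j<Suc n. g (real j / real k)) / k)
        \<le> norm (integral {0..u} g - (\<Sum>j<n. g (real j / real k)) / k) + \<epsilon> * (v - u)"
      unfolding eq by (intro order_trans[OF norm_triangle_ineq] add_left_mono)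
    also have "\<dots> \<le> u * \<epsilon> + \<epsilon> * (v - u)" using Suc by (simp add: u_def)
    also have "\<dots> = v * \<epsilon>" by (simp add: algebra_simps)
    finally show ?case by (simp only: v_def)
  qed simp
  from this[of k] show ?thesis using assms(2) by simp
qed

text \<open>The normalisation D and the mass \<theta> are kept separate from the size of P, so that
  the lemma fits a single residue class, of mass 1/m, divided by the number of all
  fractions.\<close>

lemma equidistributed_sum_limit:
  fixes P :: "nat \<Rightarrow> 'z set" and X :: "'z \<Rightarrow> real" and g :: "real \<Rightarrow> complex" and D :: "nat \<Rightarrow> real"
  assumes fin: "\<And>N. finite (P N)" and X: "\<And>N z. z \<in> P N \<Longrightarrow> 0 \<le> X z \<and> X z < 1"
    and lim: "\<And>a b. 0 \<le> a \<Longrightarrow> a \<le> b \<Longrightarrow> b \<le> 1 \<Longrightarrow>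
      (\<lambda>N. real (card {z \<in> P N. a \<le> X z \<and> X z < b}) / D N) \<longlonglongrightarrow> \<theta> * (b - a)"
    and D: "\<And>N. D N \<ge> 0"
    and g: "continuous_on {0..1} g"
  shows "(\<lambda>N. (\<Sum>z\<in>P N. g (X z)) / of_real (D N)) \<longlonglongrightarrow> of_real \<theta> * integral {0..1} g"
proof (rule tendstoI)
  fix e :: real assume e: "e > 0"
  have total: "(\<lambda>N. real (card (P N)) / D N) \<longlonglongrightarrow> \<theta>"
  proof -
    have "{z \<in> P N. 0 \<le> X z \<and> X z < 1} = P N" for N using X by auto
    then show ?thesis using lim[of 0 1] by simp
  qed
  have \<theta>: "\<theta> \<ge> 0"
    by (rule tendsto_lowerbound[OF total]) (use D in auto)
  \<comment> \<open>The errors are \<epsilon> (\<theta> + 1) from replacing g by a step function,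
    \<epsilon> from the limit of its sums, and \<theta> \<epsilon> from the Riemann sum; together
    they stay below \<epsilon> (2 \<theta> + 3).\<close>
  define \<epsilon> where "\<epsilon> = e / (2 * \<theta> + 3)"
  have \<epsilon>: "\<epsilon> > 0" using e \<theta> by (simp add: \<epsilon>_def)
  have "uniformly_continuous_on {0..1} g" by (intro compact_uniformly_continuous g) auto
  then obtain \<eta> where \<eta>: "\<eta> > 0"
    "\<And>x y. x \<in> {0..1} \<Longrightarrow> y \<in> {0..1} \<Longrightarrow> dist x y < \<eta> \<Longrightarrow> dist (g x) (g y) < \<epsilon>"
    using \<epsilon> unfolding uniformly_continuous_on_def by metis
  obtain k :: nat where k: "1 / \<eta> < real k" using reals_Archimedean2 by blast
  have "real k > 0" using k \<eta>(1) by (smt (verit) divide_pos_pos)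
  then have kpos: "k > 0" by simp
  have k\<eta>: "1 / real k < \<eta>" using k \<eta>(1) kpos by (simp add: field_simps)
  have near: "norm (g x - g y) \<le> \<epsilon>" if "x \<in> {0..1}" "y \<in> {0..1}" "\<bar>x - y\<bar> \<le> 1 / k" for x y
    using \<eta>(2)[OF that(1,2)] that(3) k\<eta> by (simp add: dist_norm)
  define I where "I j N = {z \<in> P N. real j / k \<le> X z \<and> X z < real (Suc j) / k}" for j N
  \<comment> \<open>The normalised sum of the step function that takes on each cell the value of g
    at its left end.\<close>
  define T where "T N = (\<Sum>j<k. of_real (real (card (I j N)) / D N) * g (real j / real k))" for N
  have T: "T \<longlonglongrightarrow> (\<Sum>j<k. of_real (\<theta> * (1 / k)) * g (real j / real k))"
    unfolding T_def
  proof (intro tendsto_sum tendsto_mult tendsto_const tendsto_of_real)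
    fix j assume "j \<in> {..<k}"
    then have "real (Suc j) \<le> real k" by (simp del: of_nat_Suc)
    then have "real (Suc j) / k \<le> 1" using kpos by simp
    moreover have "real (Suc j) / k - real j / k = 1 / k" by (simp add: diff_divide_distrib[symmetric])
    ultimately show "(\<lambda>N. real (card (I j N)) / D N) \<longlonglongrightarrow> \<theta> * (1 / k)"
      using lim[of "real j / k" "real (Suc j) / k"] by (simp add: I_def divide_right_mono)
  qed
  have limT: "norm ((\<Sum>j<k. of_real (\<theta> * (1 / k)) * g (real j / real k)) - of_real \<theta> * integral {0..1} g) \<le> \<theta> * \<epsilon>"
  proof -
    have "(\<Sum>j<k. of_real (\<theta> * (1 / k)) * g (real j / real k)) - of_real \<theta> * integral {0..1} g =
        - of_real \<theta> * (integral {0..1} g - (\<Sum>j<k. g (real j / real k)) / k)"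
      by (simp add: sum_distrib_left sum_divide_distrib algebra_simps sum_negf)
    then show ?thesis
      using norm_integral_Riemann_sum[OF g kpos near] \<theta>
      by (simp add: norm_mult mult_left_mono)
  qed
  have step: "norm ((\<Sum>z\<in>P N. g (X z)) / of_real (D N) - T N) \<le> \<epsilon> * (real (card (P N)) / D N)" for N
  proof -
    define J where "J z = nat \<lfloor>X z * k\<rfloor>" for z
    have J: "J z < k" "real (J z) / k \<le> X z" "X z < real (Suc (J z)) / k" if "z \<in> P N" for z
    proof -
      have 0: "0 \<le> X z * k" "X z * k < k" using X[OF that] kpos by auto
      then have 1: "real (J z) = \<lfloor>X z * k\<rfloor>" by (simp add: J_def)
      then have "real (J z) \<le> X z * k" "X z * k < real (Suc (J z))" by simp_all linarith+
      then show "real (J z) / k \<le> X z" "X z < real (Suc (J z)) / k"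
        using kpos by (simp_all add: pos_divide_le_eq pos_less_divide_eq)
      show "J z < k" using 0 1 by linarith
    qed
    have fib: "{z \<in> P N. J z = j} = I j N" for j
    proof (intro set_eqI iffI)
      fix z assume "z \<in> I j N"
      then have z: "z \<in> P N" "real j \<le> X z * k" "X z * k < real (Suc j)"
        using kpos by (auto simp: I_def pos_divide_le_eq pos_less_divide_eq)
      then have "\<lfloor>X z * k\<rfloor> = int j" by (intro floor_unique) auto
      then show "z \<in> {z \<in> P N. J z = j}" using z by (simp add: J_def)
    next
      fix z assume "z \<in> {z \<in> P N. J z = j}"
      then show "z \<in> I j N" using J[of z] by (auto simp: I_def)
    qed
    have "(\<Sum>z\<in>P N. g (J z / k)) = (\<Sum>j<k. \<Sum>z | z \<in> P N \<and> J z = j. g (J z / k))"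
      using fin J by (intro sum.group[symmetric]) auto
    also have "\<dots> = (\<Sum>j<k. \<Sum>z\<in>I j N. g (real j / real k))"
      unfolding fib[symmetric] by (intro sum.cong) auto
    finally have "T N = (\<Sum>z\<in>P N. g (J z / k)) / of_real (D N)"
      by (simp add: T_def sum_divide_distrib)
    then have "(\<Sum>z\<in>P N. g (X z)) / of_real (D N) - T N = (\<Sum>z\<in>P N. g (X z) - g (J z / k)) / of_real (D N)"
      by (simp add: sum_subtractf diff_divide_distrib)
    also have "norm \<dots> = norm (\<Sum>z\<in>P N. g (X z) - g (J z / k)) / D N" using D by (simp add: norm_divide)
    also have "\<dots> \<le> (\<Sum>z\<in>P N. \<epsilon>) / D N"
    proof (intro divide_right_mono D sum_norm_le near)
      fix z assume z: "z \<in> P N"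
      show "X z \<in> {0..1}" using X[OF z] by auto
      show "real (J z) / k \<in> {0..1}" using J[OF z] X[OF z] by auto
      have "real (Suc (J z)) / k = real (J z) / k + 1 / k" by (simp add: add_divide_distrib)
      then show "\<bar>X z - real (J z) / k\<bar> \<le> 1 / k" using J[OF z] by linarith
    qed
    finally show ?thesis by (simp add: mult.commute)
  qed
  have "\<forall>\<^sub>F N in sequentially. dist (T N) (\<Sum>j<k. of_real (\<theta> * (1 / k)) * g (real j / real k)) < \<epsilon>"
    by (rule tendstoD[OF T \<epsilon>])
  moreover have "\<forall>\<^sub>F N in sequentially. real (card (P N)) / D N < \<theta> + 1"
    by (rule order_tendstoD(2)[OF total]) simp
  ultimately show "\<forall>\<^sub>F N in sequentially.
      dist ((\<Sum>z\<in>P N. g (X z)) / of_real (D N)) (of_real \<theta> * integral {0..1} g) < e"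
  proof eventually_elim
    case (elim N)
    define A B C E where "A = (\<Sum>z\<in>P N. g (X z)) / of_real (D N)" and "B = T N"
      and "C = (\<Sum>j<k. of_real (\<theta> * (1 / k)) * g (real j / real k))" and "E = of_real \<theta> * integral {0..1} g"
    have "dist A E \<le> dist A B + dist B C + dist C E" by (metis add_right_mono dist_triangle order_trans)
    moreover have "dist A B \<le> \<epsilon> * (\<theta> + 1)"
      using step[of N] elim(2) \<epsilon> unfolding A_def B_def dist_norm
      by (meson less_imp_le mult_left_mono order_trans)
    moreover have "dist B C < \<epsilon>" using elim(1) by (simp add: B_def C_def)
    moreover have "dist C E \<le> \<theta> * \<epsilon>" using limT by (simp add: C_def E_def dist_norm)
    moreover have "\<epsilon> * (\<theta> + 1) + \<epsilon> + \<theta> * \<epsilon> \<le> e"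
    proof -
      have "\<epsilon> * (\<theta> + 1) + \<epsilon> + \<theta> * \<epsilon> \<le> \<epsilon> * (2 * \<theta> + 3)" using \<epsilon> by (simp add: algebra_simps)
      also have "\<dots> = e" using \<theta> by (simp add: \<epsilon>_def)
      finally show ?thesis .
    qed
    ultimately show ?case unfolding A_def[symmetric] E_def[symmetric] by linarith
  qed
qed

section \<open>The Haar integral\<close>

lemma to_rz_surj:
  obtains x where "0 \<le> x" "x < 1" "y = to_rz x"
proof -
  have "\<exists>r. y = to_rz r" by (transfer, unfold rz_rel_def) (metis diff_self Ints_0)
  then obtain r where "y = to_rz r" by blast
  moreover have "to_rz r = to_rz (frac r)" by (simp add: to_rz_eq_iff frac_def)
  ultimately show ?thesis using that[of "frac r"] by (simp add: frac_lt_1)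
qed

lemma sets_lebesgue_rz [measurable_cong]: "sets lebesgue_rz = sets borel"
  by (simp add: lebesgue_rz_def)

lemma measurable_to_rz: "to_rz \<in> measurable (uniform_measure lborel {0..<1}) borel"
  using borel_measurable_continuous_onI[OF continuous_on_to_rz] by (simp cong: measurable_cong_sets)

lemma finite_measure_lebesgue_rz: "finite_measure lebesgue_rz"
proof
  have "emeasure lebesgue_rz (space lebesgue_rz) = 1"
    unfolding lebesgue_rz_def using measurable_to_rz by (simp add: emeasure_distr)
  then show "emeasure lebesgue_rz (space lebesgue_rz) \<noteq> \<infinity>" by simp
qed

lemma integral_lebesgue_rz:
  fixes g :: "real_mod_1 \<Rightarrow> complex"
  assumes "continuous_on UNIV g"
  shows "integral\<^sup>L lebesgue_rz g = integral {0..1} (\<lambda>x. g (to_rz x))"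
proof -
  have cont: "continuous_on A (\<lambda>x. g (to_rz x))" for A
    by (rule continuous_on_compose2[OF assms continuous_on_to_rz]) auto
  have g: "g \<in> borel_measurable borel" using assms by (rule borel_measurable_continuous_onI)
  have gm: "(\<lambda>x. g (to_rz x)) \<in> borel_measurable lborel"
    using borel_measurable_continuous_onI[OF cont] by simp
  have "uniform_measure lborel {0..<1::real} = density lborel (\<lambda>x. ennreal (indicator {0..<1} x))"
    unfolding uniform_measure_def by (intro density_cong) (auto simp: ennreal_indicator divide_ennreal_def)
  then have "integral\<^sup>L lebesgue_rz g = (LINT x:{0..<1}|lborel. g (to_rz x))"
    unfolding lebesgue_rz_def integral_distr[OF measurable_to_rz g]
    using gm by (simp add: integral_density set_lebesgue_integral_def)
  also have "\<dots> = integral {0..<1} (\<lambda>x. g (to_rz x))"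
  proof (rule set_borel_integral_eq_integral(2))
    have "set_integrable lborel {0..1} (\<lambda>x. g (to_rz x))"
      by (rule borel_integrable_atLeastAtMost') (rule cont)
    then show "set_integrable lborel {0..<1} (\<lambda>x. g (to_rz x))"
      by (rule set_integrable_subset) auto
  qed
  also have "\<dots> = integral {0..1} (\<lambda>x. g (to_rz x))"
  proof (rule integral_spike_set)
    show "negligible {x \<in> {0..<1} - {0..1}. g (to_rz x) \<noteq> 0}" by (simp add: negligible_subset[of "{}"])
    show "negligible {x \<in> {0..1} - {0..<1}. g (to_rz x) \<noteq> 0}"
      by (rule negligible_subset[of "{1}"]) auto
  qed
  finally show ?thesis .
qed

lemma continuous_on_slice:
  fixes f :: "real_mod_1 \<times> int \<Rightarrow> complex"
  assumes "continuous_on (UNIV \<times> A) f" "s \<in> A"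
  shows "continuous_on UNIV (\<lambda>x. f (x, s))"
  by (rule continuous_on_compose2[OF assms(1)]) (use assms(2) in \<open>auto intro!: continuous_intros\<close>)

text \<open>Fubini with a finite second factor. Continuity is given only over the residues
  \<open>{0..<m}\<close>, so measurability is assembled from the slices; each slice is bounded
  because the circle is the image of the compact interval [0, 1].\<close>

lemma integral_haar_rz_zm:
  fixes f :: "real_mod_1 \<times> int \<Rightarrow> complex"
  assumes "m > 0" "continuous_on (UNIV \<times> {0..<m}) f"
  shows "integral\<^sup>L (haar_rz_zm m) f =
    (\<Sum>s\<in>{0..<m}. of_real (1 / m) * integral {0..1} (\<lambda>x. f (to_rz x, s)))"
proof -
  define U where "U = uniform_count_measure {0..<m}"
  have U: "sets U = sets (count_space {0..<m})" "space U = {0..<m}"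
    by (simp_all add: U_def space_uniform_count_measure sets_uniform_count_measure_count_space)
  interpret R: finite_measure lebesgue_rz by (rule finite_measure_lebesgue_rz)
  interpret U: finite_measure U
  proof
    show "emeasure U (space U) \<noteq> \<infinity>"
      unfolding U_def using assms(1) by (simp add: emeasure_uniform_count_measure space_uniform_count_measure)
  qed
  interpret RU: pair_sigma_finite lebesgue_rz U ..
  interpret P: finite_measure "lebesgue_rz \<Otimes>\<^sub>M U"
    by (rule finite_measure_pair_measure) unfold_locales
  have cont: "continuous_on UNIV (\<lambda>x. f (x, s))" if "s \<in> {0..<m}" for s
    using continuous_on_slice[OF assms(2) that] .
  have meas: "(\<lambda>x. f (x, s)) \<in> borel_measurable lebesgue_rz" if "s \<in> {0..<m}" for s
    using borel_measurable_continuous_onI[OF cont[OF that]] sets_lebesgue_rz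
    by (simp cong: measurable_cong_sets)
  have "(\<lambda>z. f (fst z, snd z)) \<in> borel_measurable (lebesgue_rz \<Otimes>\<^sub>M U)"
  proof (rule measurable_compose_countable'[where f = "\<lambda>s z. f (fst z, s)" and g = snd and I = "{0..<m}"])
    show "(\<lambda>z. f (fst z, s)) \<in> borel_measurable (lebesgue_rz \<Otimes>\<^sub>M U)" if "s \<in> {0..<m}" for s
      using measurable_compose[OF measurable_fst meas[OF that]] .
    show "snd \<in> measurable (lebesgue_rz \<Otimes>\<^sub>M U) (count_space {0..<m})"
      using measurable_snd[of lebesgue_rz U] unfolding measurable_cong_sets[OF refl U(1)] .
  qed simp
  then have fm: "f \<in> borel_measurable (lebesgue_rz \<Otimes>\<^sub>M U)" by simp
  have bounded: "\<exists>B. \<forall>x. norm (f (x, s)) \<le> B" if "s \<in> {0..<m}" for s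
  proof -
    have "continuous_on {0..1} (\<lambda>x. f (to_rz x, s))"
      by (rule continuous_on_compose2[OF cont[OF that] continuous_on_to_rz]) auto
    then have "compact ((\<lambda>x. f (to_rz x, s)) ` {0..1})" by (rule compact_continuous_image) simp
    then obtain B where B: "norm y \<le> B" if "y \<in> (\<lambda>x. f (to_rz x, s)) ` {0..1}" for y
      using compact_imp_bounded bounded_iff by metis
    have "norm (f (y, s)) \<le> B" for y
      by (rule to_rz_surj[of y]) (auto intro!: B)
    then show ?thesis by blast
  qed
  then obtain B where B: "\<And>s x. s \<in> {0..<m} \<Longrightarrow> norm (f (x, s)) \<le> B s" by metis
  have "integrable (lebesgue_rz \<Otimes>\<^sub>M U) f"
  proof (rule P.integrable_const_bound[OF _ fm])
    show "AE z in lebesgue_rz \<Otimes>\<^sub>M U. norm (f z) \<le> (\<Sum>s\<in>{0..<m}. \<bar>B s\<bar>)"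
    proof (rule AE_I2)
      fix z assume "z \<in> space (lebesgue_rz \<Otimes>\<^sub>M U)"
      then obtain x s where z: "z = (x, s)" "s \<in> {0..<m}" using U by (auto simp: space_pair_measure)
      have "norm (f z) \<le> \<bar>B s\<bar>" using B[OF z(2), of x] z(1) by simp
      also have "\<dots> \<le> (\<Sum>s\<in>{0..<m}. \<bar>B s\<bar>)" using z(2) by (intro member_le_sum) auto
      finally show "norm (f z) \<le> (\<Sum>s\<in>{0..<m}. \<bar>B s\<bar>)" .
    qed
  qed
  from RU.integral_fst'[OF this]
  have "integral\<^sup>L (haar_rz_zm m) f = (LINT x|lebesgue_rz. LINT s|U. f (x, s))"
    by (simp add: haar_rz_zm_def U_def)
  also have "\<dots> = (LINT x|lebesgue_rz. (\<Sum>s\<in>{0..<m}. (1 / m) *\<^sub>R f (x, s)))"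
    unfolding U_def uniform_count_measure_def
    using assms(1) by (subst lebesgue_integral_point_measure_finite) auto
  also have "\<dots> = (\<Sum>s\<in>{0..<m}. (LINT x|lebesgue_rz. (1 / m) *\<^sub>R f (x, s)))"
  proof (rule Bochner_Integration.integral_sum)
    fix s assume s: "s \<in> {0..<m}"
    have "integrable lebesgue_rz (\<lambda>x. f (x, s))"
      using B[OF s] by (intro R.integrable_const_bound[OF _ meas[OF s]]) auto
    then show "integrable lebesgue_rz (\<lambda>x. (1 / m) *\<^sub>R f (x, s))" by simp
  qed
  also have "\<dots> = (\<Sum>s\<in>{0..<m}. of_real (1 / m) * integral {0..1} (\<lambda>x. f (to_rz x, s)))"
    by (intro sum.cong refl) (simp add: integral_lebesgue_rz[OF cont] scaleR_conv_of_real)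
  finally show ?thesis .
qed

text \<open>The map \<open>r\<close> preserves integrals over [0, 1]. It is the identity for S_4 and
  x \<mapsto> 1 - x for S, so one argument serves both sums.\<close>

lemma haar_limit:
  fixes r :: "real \<Rightarrow> real" and P :: "nat \<Rightarrow> 'z set" and X :: "'z \<Rightarrow> real" and \<sigma> :: "'z \<Rightarrow> int" and f :: "real_mod_1 \<times> int \<Rightarrow> complex"
  assumes m: "m > 0" and fin: "\<And>N. finite (P N)"
    and X: "\<And>N z. z \<in> P N \<Longrightarrow> 0 \<le> X z \<and> X z < 1" and \<sigma>: "\<And>z. \<sigma> z \<in> {0..<m}"
    and lim: "\<And>a b s. 0 \<le> a \<Longrightarrow> a \<le> b \<Longrightarrow> b \<le> 1 \<Longrightarrow> s \<in> {0..<m} \<Longrightarrow>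
      (\<lambda>N. real (card {z \<in> P N. \<sigma> z = s \<and> a \<le> X z \<and> X z < b}) / real (card (P N)))
      \<longlonglongrightarrow> 1 / m * (b - a)"
    and f: "continuous_on (UNIV \<times> {0..<m}) f"
    and r: "continuous_on {0..1} r"
      "\<And>h :: real \<Rightarrow> complex. continuous_on UNIV h \<Longrightarrow> integral {0..1} (\<lambda>x. h (r x)) = integral {0..1} h"
  shows "(\<lambda>N. 1 / of_nat (card (P N)) * (\<Sum>z\<in>P N. f (to_rz (r (X z)), \<sigma> z)))
    \<longlonglongrightarrow> integral\<^sup>L (haar_rz_zm m) f"
proof -
  have "(\<lambda>N. \<Sum>s\<in>{0..<m}. (\<Sum>z | z \<in> P N \<and> \<sigma> z = s. f (to_rz (r (X z)), s)) / of_real (real (card (P N))))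
      \<longlonglongrightarrow> (\<Sum>s\<in>{0..<m}. of_real (1 / m) * integral {0..1} (\<lambda>x. f (to_rz x, s)))"
  proof (rule tendsto_sum)
    fix s assume s: "s \<in> {0..<m}"
    have c: "continuous_on UNIV (\<lambda>x. f (to_rz x, s))"
      by (rule continuous_on_compose2[OF continuous_on_slice[OF f s] continuous_on_to_rz]) auto
    show "(\<lambda>N. (\<Sum>z | z \<in> P N \<and> \<sigma> z = s. f (to_rz (r (X z)), s)) / of_real (real (card (P N))))
      \<longlonglongrightarrow> of_real (1 / m) * integral {0..1} (\<lambda>x. f (to_rz x, s))"
    proof (subst r(2)[symmetric], rule c, rule equidistributed_sum_limit[where g = "\<lambda>x. f (to_rz (r x), s)"])
      show "finite {z. z \<in> P N \<and> \<sigma> z = s}" for N using fin by simp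
      fix a b :: real assume "0 \<le> a" "a \<le> b" "b \<le> 1"
      from lim[OF this s]
      show "(\<lambda>N. real (card {z \<in> {z. z \<in> P N \<and> \<sigma> z = s}. a \<le> X z \<and> X z < b}) / real (card (P N)))
          \<longlonglongrightarrow> 1 / m * (b - a)" by (simp add: conj_assoc)
    next
      show "continuous_on {0..1} (\<lambda>x. f (to_rz (r x), s))"
        by (rule continuous_on_compose2[OF c r(1)]) auto
    qed (use X in auto)
  qed
  moreover have "(\<Sum>s\<in>{0..<m}. (\<Sum>z | z \<in> P N \<and> \<sigma> z = s. f (to_rz (r (X z)), s)) / of_real (real (card (P N))))
      = 1 / of_nat (card (P N)) * (\<Sum>z\<in>P N. f (to_rz (r (X z)), \<sigma> z))" for N
  proof -
    have "(\<Sum>z\<in>P N. f (to_rz (r (X z)), \<sigma> z)) =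
        (\<Sum>s\<in>{0..<m}. \<Sum>z | z \<in> P N \<and> \<sigma> z = s. f (to_rz (r (X z)), \<sigma> z))"
      using fin \<sigma> by (intro sum.group[symmetric]) auto
    also have "\<dots> = (\<Sum>s\<in>{0..<m}. \<Sum>z | z \<in> P N \<and> \<sigma> z = s. f (to_rz (r (X z)), s))"
      by (intro sum.cong) auto
    finally show ?thesis by (simp add: sum_divide_distrib)
  qed
  ultimately show ?thesis by (simp only: integral_haar_rz_zm[OF m f])
qed

section \<open>Equidistribution over \<open>Phi_4\<close>\<close>

lemma hardy_S4_residue_density:
  fixes m s :: int
  assumes "m > 0" "s \<in> {0..<m}" "0 \<le> a" "a \<le> b"
  shows "(\<lambda>N. real (card {(d, c) \<in> pts (\<lambda>d c. odd d \<and> coprime d c) a b N. hardy_S4 d c mod m = s})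
      / real (card (pts (\<lambda>d c. odd d \<and> coprime d c) 0 1 N)))
    \<longlonglongrightarrow> 1 / m * (b - a)"
proof -
  let ?A = "\<lambda>N. real (card {(d, c) \<in> pts (\<lambda>d c. odd d \<and> coprime d c) a b N. hardy_S4 d c mod m = s})"
  let ?B = "\<lambda>N. real (card (pts (\<lambda>d c. odd d \<and> coprime d c) 0 1 N))"
  have "(\<lambda>N. (?A N / (real N)\<^sup>2) / (?B N / (real N)\<^sup>2))
      \<longlonglongrightarrow> ((b - a) * (1 / (4 * odd_zeta)) / real (nat m)) / ((1 - 0) * (1 / (4 * odd_zeta)))"
  proof (rule tendsto_divide)
    show "(\<lambda>N. ?A N / (real N)\<^sup>2) \<longlonglongrightarrow> (b - a) * (1 / (4 * odd_zeta)) / real (nat m)"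
      using hardy_S4_residue_limit[of "nat m" s a b] assms by simp
    show "(\<lambda>N. ?B N / (real N)\<^sup>2) \<longlonglongrightarrow> (1 - 0) * (1 / (4 * odd_zeta))"
      by (rule card_odd_coprime_pts_limit) simp
  qed (use odd_zeta_pos in simp)
  moreover have "((b - a) * (1 / (4 * odd_zeta)) / real (nat m)) / ((1 - 0) * (1 / (4 * odd_zeta)))
      = 1 / m * (b - a)"
    using odd_zeta_pos assms(1) by (simp add: field_simps)
  moreover have "\<forall>\<^sub>F N in sequentially. (?A N / (real N)\<^sup>2) / (?B N / (real N)\<^sup>2) = ?A N / ?B N"
    using eventually_gt_at_top[of 0] by eventually_elim simp
  ultimately show ?thesis using Lim_transform_eventually by fastforce
qed

text \<open>The sector over [0, 1) would admit d = 0, but oddness excludes it.\<close>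

lemma Phi_4_eq: "Phi_4 N = pts (\<lambda>d c. odd d \<and> coprime d c) 0 1 N"
proof -
  have "1 \<le> d \<longleftrightarrow> 0 \<le> d" if "odd d" for d :: int
    using that by (cases "d = 0") auto
  then show ?thesis unfolding Phi_4_def pts_def by auto
qed

lemma Phi_4_interval:
  assumes "0 \<le> a" "b \<le> 1"
  shows "{z \<in> Phi_4 N. (case z of (d, c) \<Rightarrow> hardy_S4 d c mod m) = s \<and>
      a \<le> (case z of (d, c) \<Rightarrow> real_of_int d / real_of_int c) \<and>
      (case z of (d, c) \<Rightarrow> real_of_int d / real_of_int c) < b} =
    {(d, c) \<in> pts (\<lambda>d c. odd d \<and> coprime d c) a b N. hardy_S4 d c mod m = s}"
proof -
  have "0 \<le> d" "d < c" if "1 \<le> c" "a * real_of_int c \<le> real_of_int d" "real_of_int d < b * real_of_int c" for d c :: int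
  proof -
    have "0 \<le> a * real_of_int c" "b * real_of_int c \<le> 1 * real_of_int c"
      using assms that(1) by (auto intro!: mult_right_mono)
    then show "0 \<le> d" "d < c" using that by linarith+
  qed
  then show ?thesis
    unfolding Phi_4_eq by (auto simp: pts_def field_simps)
qed

lemma Phi_4_limit:
  fixes f :: "real_mod_1 \<times> int \<Rightarrow> complex" and r :: "real \<Rightarrow> real"
  assumes "m > 0" "continuous_on (UNIV \<times> {0..<m}) f" "continuous_on {0..1} r"
    "\<And>h :: real \<Rightarrow> complex. continuous_on UNIV h \<Longrightarrow> integral {0..1} (\<lambda>x. h (r x)) = integral {0..1} h"
  shows "(\<lambda>N. 1 / of_nat (card (Phi_4 N)) *
      (\<Sum>(d, c)\<in>Phi_4 N. f (to_rz (r (real_of_int d / real_of_int c)), hardy_S4 d c mod m)))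
    \<longlonglongrightarrow> integral\<^sup>L (haar_rz_zm m) f"
proof -
  let ?X = "\<lambda>z. case z of (d, c) \<Rightarrow> real_of_int d / real_of_int c"
  let ?S = "\<lambda>z. case z of (d, c) \<Rightarrow> hardy_S4 d c mod m"
  have "(\<lambda>N. 1 / of_nat (card (Phi_4 N)) * (\<Sum>z\<in>Phi_4 N. f (to_rz (r (?X z)), ?S z)))
    \<longlonglongrightarrow> integral\<^sup>L (haar_rz_zm m) f"
  proof (rule haar_limit[where r = r and X = ?X and \<sigma> = ?S])
    show "finite (Phi_4 N)" for N unfolding Phi_4_eq by (rule finite_pts)
    show "0 \<le> ?X z \<and> ?X z < 1" if "z \<in> Phi_4 N" for N z
      using that by (auto simp: Phi_4_def)
    show "?S z \<in> {0..<m}" for z using assms(1) by (cases z) auto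
    show "(\<lambda>N. real (card {z \<in> Phi_4 N. ?S z = s \<and> a \<le> ?X z \<and> ?X z < b}) / real (card (Phi_4 N)))
        \<longlonglongrightarrow> 1 / real_of_int m * (b - a)"
      if "0 \<le> a" "a \<le> b" "b \<le> 1" "s \<in> {0..<m}" for a b s
      using hardy_S4_residue_density[OF assms(1) that(4,1,2)]
      unfolding Phi_4_interval[OF that(1,3)] unfolding Phi_4_eq .
  qed (fact assms)+
  then show ?thesis by (simp only: case_prod_unfold)
qed

section \<open>Reflection from S_4 to S\<close>

text \<open>c - d = 2 c - (d + c), so the sign from the reflection of S_4 cancels the one in
  \<open>hardy_S_eq\<close>.\<close>

lemma hardy_S_reflect:
  assumes "c > 0" "coprime d c"
  shows "hardy_S d c = hardy_S4 (c - d) c"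
proof -
  have "coprime (d + c) c" using assms(2) by (simp add: coprime_iff_gcd_eq_1)
  from hardy_S4_reflect[OF assms(1) this] show ?thesis
    by (simp add: hardy_S_eq[OF assms(1)])
qed

text \<open>c + (c - d) has the parity of d, so d \<mapsto> c - d exchanges the two parity
  conditions.\<close>

lemma bij_betw_Phi: "bij_betw (\<lambda>(d, c). (c - d, c)) (Phi_4 N) (Phi_theta N)"
proof (rule bij_betw_byWitness[where f' = "\<lambda>(d, c). (c - d, c)"])
  have cop: "coprime (c - d) c \<longleftrightarrow> coprime d c" for c d :: int
    by (metis coprime_iff_gcd_eq_1 gcd.commute gcd_diff2)
  show "(\<lambda>(d, c). (c - d, c)) ` Phi_4 N \<subseteq> Phi_theta N"
    "(\<lambda>(d, c). (c - d, c)) ` Phi_theta N \<subseteq> Phi_4 N"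
    unfolding Phi_4_def Phi_theta_def by (auto simp: cop)
qed auto

lemma integral_reflect_unit_interval:
  fixes h :: "real \<Rightarrow> complex"
  assumes "continuous_on UNIV h"
  shows "integral {0..1} (\<lambda>x. h (1 - x)) = integral {0..1} h"
proof -
  have "(h has_integral integral {0..1} h) (cbox 0 1)"
    using integrable_integral[OF integrable_continuous_real[OF continuous_on_subset[OF assms, of "{0..1}"]]]
    by simp
  from has_integral_affinity[OF this, of "- 1" 1]
  have "((\<lambda>x. h (1 - x)) has_integral integral {0..1} h) ((\<lambda>x. 1 - x) ` {0..1})" by simp
  moreover have "(\<lambda>x. 1 - x) ` {0..1::real} = {0..1}"
  proof (intro set_eqI iffI)
    fix x :: real assume "x \<in> {0..1}"
    then show "x \<in> (\<lambda>x. 1 - x) ` {0..1}" by (intro image_eqI[of _ _ "1 - x"]) auto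
  qed auto
  ultimately show ?thesis by (metis integral_unique)
qed

theorem theorem1p1:
  fixes m :: int
  assumes "m > 1"
  shows "(\<forall>f :: real_mod_1 \<times> int \<Rightarrow> complex. continuous_on (UNIV \<times> {0..<m}) f \<longrightarrow>
            (\<lambda>N. (1 / of_nat (card (Phi_theta N))) *
                 (\<Sum>(d, c)\<in>Phi_theta N.
                    f (to_rz (real_of_int d / real_of_int c), hardy_S d c mod m)))
            \<longlonglongrightarrow> integral\<^sup>L (haar_rz_zm m) f) \<and>
         (\<forall>f :: real_mod_1 \<times> int \<Rightarrow> complex. continuous_on (UNIV \<times> {0..<m}) f \<longrightarrow>
            (\<lambda>N. (1 / of_nat (card (Phi_4 N))) *
                 (\<Sum>(d, c)\<in>Phi_4 N.
                    f (to_rz (real_of_int d / real_of_int c), hardy_S4 d c mod m)))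
            \<longlonglongrightarrow> integral\<^sup>L (haar_rz_zm m) f)"
proof (intro conjI allI impI)
  fix f :: "real_mod_1 \<times> int \<Rightarrow> complex" assume f: "continuous_on (UNIV \<times> {0..<m}) f"
  \<comment> \<open>The substitution d \<mapsto> c - d turns S into S_4 at the price of reflecting d
    / c to 1 - d / c, which Lebesgue measure on [0, 1] does not notice.\<close>
  have "(\<Sum>(d, c)\<in>Phi_theta N. f (to_rz (real_of_int d / real_of_int c), hardy_S d c mod m)) =
      (\<Sum>(d, c)\<in>Phi_4 N. f (to_rz (1 - real_of_int d / real_of_int c), hardy_S4 d c mod m))" for N
    unfolding sum.reindex_bij_betw[OF bij_betw_Phi, symmetric]
  proof (intro sum.cong refl)
    fix z assume z: "z \<in> Phi_4 N"
    obtain d c where dc: "z = (d, c)" by (cases z)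
    have "c > 0" "coprime d c" using z dc by (auto simp: Phi_4_def)
    moreover from this have "coprime (c - d) c" by (metis coprime_iff_gcd_eq_1 gcd.commute gcd_diff2)
    ultimately have "hardy_S (c - d) c = hardy_S4 d c" "real_of_int (c - d) / c = 1 - d / c"
      using hardy_S_reflect[of c "c - d"] by (simp_all add: diff_divide_distrib)
    then show "(case case z of (d, c) \<Rightarrow> (c - d, c) of
          (d, c) \<Rightarrow> f (to_rz (real_of_int d / real_of_int c), hardy_S d c mod m)) =
        (case z of (d, c) \<Rightarrow> f (to_rz (1 - real_of_int d / real_of_int c), hardy_S4 d c mod m))"
      by (simp only: dc prod.case)
  qed
  moreover have "card (Phi_theta N) = card (Phi_4 N)" for N
    using bij_betw_same_card[OF bij_betw_Phi] by simp
  ultimately show "(\<lambda>N. (1 / of_nat (card (Phi_theta N))) *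
      (\<Sum>(d, c)\<in>Phi_theta N. f (to_rz (real_of_int d / real_of_int c), hardy_S d c mod m)))
    \<longlonglongrightarrow> integral\<^sup>L (haar_rz_zm m) f"
    using Phi_4_limit[of m f "\<lambda>x. 1 - x"] f assms integral_reflect_unit_interval
    by (simp add: continuous_on_diff)
next
  fix f :: "real_mod_1 \<times> int \<Rightarrow> complex" assume "continuous_on (UNIV \<times> {0..<m}) f"
  then show "(\<lambda>N. (1 / of_nat (card (Phi_4 N))) *
      (\<Sum>(d, c)\<in>Phi_4 N. f (to_rz (real_of_int d / real_of_int c), hardy_S4 d c mod m)))
    \<longlonglongrightarrow> integral\<^sup>L (haar_rz_zm m) f"
    using Phi_4_limit[of m f "\<lambda>x. x"] assms by simp
qed

end
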